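(* Let $\mathbb{T}$ be a bounded time scale with at least three points, $a=\min\mathbb{T}$, $b=\max\mathbb{T}$, and let $n\ge 1$ be an integer. Let $L:\mathbb{R}^n\times\mathbb{R}^n\times\mathbb{T}^\kappa\to\mathbb{R}$, $(x,v,t)\mapsto L(x,v,t)$, be a Lagrangian, i.e. a continuous map of class $C^1$ in its first two variables, and let $\mathcal{L}:C^{1,\Delta}_{\mathrm{rd}}(\mathbb{T})\to\mathbb{R}$ be defined by $\mathcal{L}(u)=\int_a^b L(u(\tau),u^\Delta(\tau),\tau)\,\Delta\tau$. Assume that the forward jump operator $\sigma$ is $\nabla$-differentiable on $\mathbb{T}_\kappa$, and let $u\in C^{1,\Delta}_{\mathrm{rd}}(\mathbb{T})$. Then $u$ is a critical point of $\mathcal{L}$ if and only if $u$ is a solution of the $\nabla\circ\Delta$-differential Euler-Lagrange equation $$\left[\frac{\partial L}{\partial v}(u,u^\Delta,\cdot)\right]^\nabla(t)=\sigma^\nabla(t)\,\frac{\partial L}{\partial x}(u(t),u^\Delta(t),t)\qquad\text{for every } t\in\mathbb{T}^\kappa_\kappa .$$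
   Context: A time scale is a nonempty closed subset $\mathbb{T}$ of $\mathbb{R}$; here it is bounded, $a=\min\mathbb{T}$, $b=\max\mathbb{T}$, $\mathrm{card}(\mathbb{T})\ge 3$. Jump operators $\rho,\sigma:\mathbb{T}\to\mathbb{T}$: $\rho(t)=\sup\{s\in\mathbb{T}: s<t\}$, $\sigma(t)=\inf\{s\in\mathbb{T}: s>t\}$, with $\sup\emptyset=a$ and $\inf\emptyset=b$. A point $t$ is right-dense if $t\ne b$ and $\sigma(t)=t$; it is left-dense if $t\neq a$ and $\rho(t)=t$. Set $\mathbb{T}^\kappa=\mathbb{T}\setminus(\rho(b),b]$, $\mathbb{T}_\kappa=\mathbb{T}\setminus[a,\sigma(a))$, $\mathbb{T}^\kappa_\kappa=\mathbb{T}^\kappa\cap\mathbb{T}_\kappa$. A function $u:\mathbb{T}\to\mathbb{R}^n$ is $\Delta$-differentiable at $t\in\mathbb{T}^\kappa$ if $u^\Delta(t)=\lim_{s\to t,\ s\ne\sigma(t)}\frac{u(\sigma(t))-u(s)}{\sigma(t)-s}$ exists in $\mathbb{R}^n$, and $\nabla$-differentiable at $t\in\mathbb{T}_\kappa$ if $u^\nabla(t)=\lim_{s\to t,\ s\ne\rho(t)}\frac{u(s)-u(\rho(t))}{s-\rho(t)}$ exists in $\mathbb{R}^n$. In these limits $s$ ranges over $\mathbb{T}$, and $s=t$ is allowed when $t\neq\sigma(t)$ (resp. $t\neq\rho(t)$). A function is rd-continuous if it is continuous at every right-dense point and has a left-sided limit at every left-dense point. $C^{1,\Delta}_{\mathrm{rd}}(\mathbb{T})$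 is the space of functions $\mathbb{T}\to\mathbb{R}^n$ that are $\Delta$-differentiable on $\mathbb{T}^\kappa$ with rd-continuous $\Delta$-derivative. $\int\Delta\tau$ is the Cauchy $\Delta$-integral: for $f$ rd-continuous on $\mathbb{T}^\kappa$, $F(t)=\int_a^t f(\tau)\,\Delta\tau$ is the unique function on $\mathbb{T}$ with $F^\Delta=f$ on $\mathbb{T}^\kappa$ and $F(a)=0$. Let $C^{1,\Delta}_{\mathrm{rd},0}(\mathbb{T})=\{w\in C^{1,\Delta}_{\mathrm{rd}}(\mathbb{T}): w(a)=w(b)=0\}$. A function $u\in C^{1,\Delta}_{\mathrm{rd}}(\mathbb{T})$ is a critical point of $\mathcal{L}$ if $D\mathcal{L}(u)(w)=0$ for every $w\in C^{1,\Delta}_{\mathrm{rd},0}(\mathbb{T})$, where $D\mathcal{L}(u)(w)$ is the Gâteaux differential of $\mathcal{L}$ at $u$ in direction $w$. $\frac{\partial L}{\partial v}(u,u^\Delta,\cdot)$ denotes the function $t\mapsto\frac{\partial L}{\partial v}(u(t),u^\Delta(t),t)$, defined on $\mathbb{T}^\kappa$; its $\nabla$-derivative at $t\in\mathbb{T}^\kappa_\kappa$ is defined by the limit above with $s$ ranging over $\mathbb{T}^\kappa$. Being a solution of the equation means that this function is $\nabla$-differentiable at every $t\in\mathbb{T}^\kappa_\kappa$ and that the equality holds there. *)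

theory Defs
  imports "HOL-Analysis.Analysis"
begin

text \<open>
  Functions on a time scale \<open>T\<close> (or on a subset of it) are represented by total functions on
  \<^typ>\<open>real\<close>; every notion below depends only on their values on the set in question.
  For bounded \<open>T\<close>, the points \<open>min T\<close> and \<open>max T\<close> are \<open>Inf T\<close> and \<open>Sup T\<close>.
\<close>

definition time_scale :: "real set \<Rightarrow> bool" where
  "time_scale T \<longleftrightarrow> T \<noteq> {} \<and> closed T"

definition rho :: "real set \<Rightarrow> real \<Rightarrow> real" where
  "rho T t = (if {s \<in> T. s < t} = {} then Inf T else Sup {s \<in> T. s < t})"

definition sigma :: "real set \<Rightarrow> real \<Rightarrow> real" where
  "sigma T t = (if {s \<in> T. t < s} = {} then Sup T else Inf {s \<in> T. t < s})"

definition right_dense :: "real set \<Rightarrow> real \<Rightarrow> bool" where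
  "right_dense T t \<longleftrightarrow> t \<noteq> Sup T \<and> sigma T t = t"

definition left_dense :: "real set \<Rightarrow> real \<Rightarrow> bool" where
  "left_dense T t \<longleftrightarrow> t \<noteq> Inf T \<and> rho T t = t"

definition upper_kappa :: "real set \<Rightarrow> real set" where
  "upper_kappa T = T - {rho T (Sup T)<..Sup T}"

definition lower_kappa :: "real set \<Rightarrow> real set" where
  "lower_kappa T = T - {Inf T..<sigma T (Inf T)}"

text \<open>
  The limits are taken as \<open>s\<close> tends to \<open>t\<close> in \<open>T - {sigma T t}\<close>, where \<open>s = t\<close> is not excluded
  unless \<open>sigma T t = t\<close>. Hence the filter is not \<open>at t within _\<close>.
\<close>

definition has_delta_deriv ::
    "real set \<Rightarrow> (real \<Rightarrow> 'a::real_normed_vector) \<Rightarrow> 'a \<Rightarrow> real \<Rightarrow> bool" where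
  "has_delta_deriv T u D t \<longleftrightarrow>
     ((\<lambda>s. (u (sigma T t) - u s) /\<^sub>R (sigma T t - s)) \<longlongrightarrow> D)
       (inf (nhds t) (principal (T - {sigma T t})))"

definition delta_deriv :: "real set \<Rightarrow> (real \<Rightarrow> 'a::real_normed_vector) \<Rightarrow> real \<Rightarrow> 'a" where
  "delta_deriv T u t = (THE D. has_delta_deriv T u D t)"

text \<open>
  The additional argument \<open>S \<subseteq> T\<close> is the domain of the function; the backward jump is that of \<open>T\<close>.
\<close>

definition has_nabla_deriv ::
    "real set \<Rightarrow> real set \<Rightarrow> (real \<Rightarrow> 'a::real_normed_vector) \<Rightarrow> 'a \<Rightarrow> real \<Rightarrow> bool" where
  "has_nabla_deriv T S f D t \<longleftrightarrow>
     ((\<lambda>s. (f s - f (rho T t)) /\<^sub>R (s - rho T t)) \<longlongrightarrow> D)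
       (inf (nhds t) (principal (S - {rho T t})))"

definition nabla_deriv ::
    "real set \<Rightarrow> real set \<Rightarrow> (real \<Rightarrow> 'a::real_normed_vector) \<Rightarrow> real \<Rightarrow> 'a" where
  "nabla_deriv T S f t = (THE D. has_nabla_deriv T S f D t)"

definition rd_continuous_on ::
    "real set \<Rightarrow> real set \<Rightarrow> (real \<Rightarrow> 'a::real_normed_vector) \<Rightarrow> bool" where
  "rd_continuous_on T S f \<longleftrightarrow>
     (\<forall>t\<in>S. right_dense T t \<longrightarrow> continuous (at t within S) f) \<and>
     (\<forall>t\<in>S. left_dense T t \<longrightarrow> (\<exists>l. (f \<longlongrightarrow> l) (at t within S \<inter> {..<t})))"

definition C1rd :: "real set \<Rightarrow> (real \<Rightarrow> 'a::real_normed_vector) set" where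
  "C1rd T = {u. (\<forall>t\<in>upper_kappa T. \<exists>D. has_delta_deriv T u D t) \<and>
                rd_continuous_on T (upper_kappa T) (delta_deriv T u)}"

definition C1rd0 :: "real set \<Rightarrow> (real \<Rightarrow> 'a::real_normed_vector) set" where
  "C1rd0 T = {w \<in> C1rd T. w (Inf T) = 0 \<and> w (Sup T) = 0}"

text \<open>
  The Cauchy integral of \<open>f\<close> from \<open>Inf T\<close> to \<open>t\<close>: the antiderivative vanishing at \<open>Inf T\<close> is unique
  only on \<open>T\<close>, so the description operator is applied to its value at \<open>t\<close>.
\<close>

definition delta_integral :: "real set \<Rightarrow> (real \<Rightarrow> 'a::real_normed_vector) \<Rightarrow> real \<Rightarrow> 'a" where
  "delta_integral T f t =
     (THE y. \<exists>F. (\<forall>s\<in>upper_kappa T. has_delta_deriv T F (f s) s) \<and> F (Inf T) = 0 \<and> F t = y)"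

definition gradient :: "('a::real_inner \<Rightarrow> real) \<Rightarrow> 'a \<Rightarrow> 'a" where
  "gradient f x = (THE D. GDERIV f x :> D)"

definition dL_dx :: "('a::real_inner \<Rightarrow> 'a \<Rightarrow> real \<Rightarrow> real) \<Rightarrow> 'a \<Rightarrow> 'a \<Rightarrow> real \<Rightarrow> 'a" where
  "dL_dx L x v t = gradient (\<lambda>y. L y v t) x"

definition dL_dv :: "('a::real_inner \<Rightarrow> 'a \<Rightarrow> real \<Rightarrow> real) \<Rightarrow> 'a \<Rightarrow> 'a \<Rightarrow> real \<Rightarrow> 'a" where
  "dL_dv L x v t = gradient (\<lambda>y. L x y t) v"

text \<open>
  Class \<open>C\<^sup>1\<close> in the first two variables includes joint continuity of the partial derivatives in
  \<open>(x, v, t)\<close>.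
\<close>

definition lagrangian :: "real set \<Rightarrow> ('a::real_inner \<Rightarrow> 'a \<Rightarrow> real \<Rightarrow> real) \<Rightarrow> bool" where
  "lagrangian T L \<longleftrightarrow>
     continuous_on (UNIV \<times> UNIV \<times> upper_kappa T) (\<lambda>(x, v, t). L x v t) \<and>
     (\<forall>t\<in>upper_kappa T. \<forall>x v. (\<lambda>(y, z). L y z t) differentiable at (x, v)) \<and>
     continuous_on (UNIV \<times> UNIV \<times> upper_kappa T) (\<lambda>(x, v, t). dL_dx L x v t) \<and>
     continuous_on (UNIV \<times> UNIV \<times> upper_kappa T) (\<lambda>(x, v, t). dL_dv L x v t)"

definition lagrangian_functional ::
    "real set \<Rightarrow> ('a::real_inner \<Rightarrow> 'a \<Rightarrow> real \<Rightarrow> real) \<Rightarrow> (real \<Rightarrow> 'a) \<Rightarrow> real" where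
  "lagrangian_functional T L u =
     delta_integral T (\<lambda>t. L (u t) (delta_deriv T u t) t) (Sup T)"

definition has_gateaux_differential ::
    "((real \<Rightarrow> 'a::real_vector) \<Rightarrow> real) \<Rightarrow> (real \<Rightarrow> 'a) \<Rightarrow> (real \<Rightarrow> 'a) \<Rightarrow> real \<Rightarrow> bool" where
  "has_gateaux_differential J u w d \<longleftrightarrow>
     ((\<lambda>\<epsilon>. (J (\<lambda>t. u t + \<epsilon> *\<^sub>R w t) - J u) / \<epsilon>) \<longlongrightarrow> d) (at 0)"

definition critical_point ::
    "real set \<Rightarrow> ('a::real_inner \<Rightarrow> 'a \<Rightarrow> real \<Rightarrow> real) \<Rightarrow> (real \<Rightarrow> 'a) \<Rightarrow> bool" where
  "critical_point T L u \<longleftrightarrow>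
     u \<in> C1rd T \<and>
     (\<forall>w\<in>C1rd0 T. has_gateaux_differential (lagrangian_functional T L) u w 0)"

end

theory Submission
  imports Defs
begin

text \<open>
  The equation is the du Bois-Reymond form of criticality, differentiated. Write \<open>p\<close> and \<open>q\<close> for
  the partial derivatives of \<open>L\<close> in \<open>x\<close> and \<open>v\<close> along \<open>(u, u\<^sup>\<Delta>)\<close>. The Gateaux differential of the
  functional in direction \<open>w\<close> is \<open>\<integral> (p \<bullet> w + q \<bullet> w\<^sup>\<Delta>) \<Delta>t\<close> (\<open>gateaux_differential\<close>). Let \<open>P\<close> be the
  antiderivative of \<open>p\<close>. The product rule is \<open>(P \<bullet> w)\<^sup>\<Delta> = p \<bullet> w + (P \<circ> \<sigma>) \<bullet> w\<^sup>\<Delta>\<close>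
  (\<open>has_delta_deriv_inner\<close>), so for \<open>w\<close> vanishing at both ends integration by parts turns the
  differential into \<open>\<integral> g \<bullet> w\<^sup>\<Delta> \<Delta>t\<close> with \<open>g = q - P \<circ> \<sigma>\<close>. It vanishes for all such \<open>w\<close> exactly when
  \<open>g\<close> is constant on the domain of \<open>u\<^sup>\<Delta>\<close> (\<open>du_Bois_Reymond\<close>). A function there is constant exactly
  when its nabla derivative is zero (\<open>nabla_zero_imp_constant\<close>), and
  \<open>(P \<circ> \<sigma>)\<^sup>\<nabla> = \<sigma>\<^sup>\<nabla> p\<close> (\<open>has_nabla_deriv_comp_sigma\<close>). Hence \<open>g\<close> is constant if and only if
  \<open>q\<^sup>\<nabla> = \<sigma>\<^sup>\<nabla> p\<close>.

  Differentiability of \<open>\<sigma>\<close> enters twice. It gives the chain rule for \<open>P \<circ> \<sigma>\<close>. It also makes \<open>\<sigma>\<close>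
  continuous, which excludes points that are left-dense and right-scattered
  (\<open>sigma_eq_if_left_dense\<close>). Without such points, an rd-continuous delta derivative is continuous
  (\<open>C1rd_continuous\<close>), so that \<open>p\<close>, \<open>q\<close> and \<open>g\<close> are continuous on a compact set.

  Two tools replace the classical calculus. Uniqueness and all estimates rest on a mean value
  inequality for functions on a compact set of reals (\<open>norm_diff_le_of_forward_steps\<close>). Existence of
  antiderivatives comes from the ordinary integral: a function on the time scale is extended to
  the gaps by its value at the left end point of the gap (\<open>antiderivative_exists\<close>).
\<close>

section \<open>Difference quotients and a mean value inequality\<close>

lemma has_vector_derivative_iff_quotient:
  fixes f :: "real \<Rightarrow> 'a::real_normed_vector"
  shows "(f has_vector_derivative D) (at t within S) \<longleftrightarrow>
    ((\<lambda>s. (f s - f t) /\<^sub>R (s - t)) \<longlongrightarrow> D) (at t within S)"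
proof -
  have "norm (f s - f t - (s - t) *\<^sub>R D) / norm (s - t) = norm ((f s - f t) /\<^sub>R (s - t) - D)"
    if "s \<noteq> t" for s
  proof -
    have "f s - f t - (s - t) *\<^sub>R D = (s - t) *\<^sub>R ((f s - f t) /\<^sub>R (s - t) - D)"
      using that by (simp add: scaleR_diff_right)
    then show ?thesis using that by simp
  qed
  then have "((\<lambda>s. norm (f s - f t - (s - t) *\<^sub>R D) / norm (s - t)) \<longlongrightarrow> 0) (at t within S) \<longleftrightarrow>
      ((\<lambda>s. norm ((f s - f t) /\<^sub>R (s - t) - D)) \<longlongrightarrow> 0) (at t within S)"
    by (intro filterlim_cong refl) (auto simp: eventually_at_filter)
  then show ?thesis
    by (simp add: has_vector_derivative_def has_derivative_iff_norm bounded_linear_scaleR_left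
        tendsto_norm_zero_iff LIM_zero_iff)
qed

text \<open>
  When \<open>c \<noteq> t\<close>, the point \<open>t\<close> itself belongs to the set along which the limit is taken, so the limit
  is forced to be the value of the quotient at \<open>t\<close> and its existence amounts to continuity of \<open>f\<close>.
  This is the situation at a scattered point, with \<open>c\<close> the neighbour of \<open>t\<close>.
\<close>

lemma tendsto_difference_quotient_iff:
  fixes f :: "real \<Rightarrow> 'a::real_normed_vector"
  assumes "t \<in> S" "c \<noteq> t"
  shows "((\<lambda>s. (f s - y) /\<^sub>R (s - c)) \<longlongrightarrow> D) (inf (nhds t) (principal (S - {c}))) \<longleftrightarrow>
    continuous (at t within S) f \<and> f t - y = (t - c) *\<^sub>R D" (is "(?q \<longlongrightarrow> D) ?F \<longleftrightarrow> _")
proof -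
  have tF: "P t" if "eventually P ?F" for P
    using that assms by (auto simp: eventually_inf_principal dest: eventually_nhds_x_imp_x)
  have le: "?F = inf (nhds t) (principal S)"
  proof (rule antisym)
    show "?F \<le> inf (nhds t) (principal S)" by (intro inf_mono) auto
    have "eventually (\<lambda>s. s \<noteq> c) (nhds t)"
      using t1_space_nhds[of t c] assms(2) by simp
    then show "inf (nhds t) (principal S) \<le> ?F"
      unfolding le_inf_iff
      by (auto simp: le_principal eventually_inf_principal elim!: eventually_mono)
  qed
  have eq: "(g \<longlongrightarrow> l) ?F \<longleftrightarrow> (g \<longlongrightarrow> l) (at t within S) \<and> g t = l" for g :: "real \<Rightarrow> 'a" and l
  proof
    assume *: "(g \<longlongrightarrow> l) ?F"
    have "g t = l"
    proof (rule ccontr)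
      assume "g t \<noteq> l"
      then have "eventually (\<lambda>s. g s \<in> - {g t}) ?F"
        by (intro topological_tendstoD[OF *]) (auto simp: open_Compl)
      from tF[OF this] show False by simp
    qed
    moreover have "at t within S \<le> ?F" unfolding le at_within_def by (intro inf_mono) auto
    ultimately show "(g \<longlongrightarrow> l) (at t within S) \<and> g t = l"
      using * tendsto_mono by blast
  next
    assume *: "(g \<longlongrightarrow> l) (at t within S) \<and> g t = l"
    show "(g \<longlongrightarrow> l) ?F"
    proof (rule topological_tendstoI)
      fix U assume "open U" "l \<in> U"
      then have "eventually (\<lambda>s. g s \<in> U) (at t within S)" using * topological_tendstoD by blast
      then show "eventually (\<lambda>s. g s \<in> U) ?F"
        unfolding le using * \<open>l \<in> U\<close>
        by (auto simp: eventually_at_filter eventually_inf_principal elim!: eventually_mono)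
    qed
  qed
  show ?thesis
  proof
    assume q: "(?q \<longlongrightarrow> D) ?F"
    then have "?q t = D" by (simp add: eq)
    then have D: "f t - y = (t - c) *\<^sub>R D"
      using assms(2) by auto
    have "((\<lambda>s. y + (s - c) *\<^sub>R ?q s) \<longlongrightarrow> y + (t - c) *\<^sub>R D) ?F"
      by (intro tendsto_intros q) (auto intro!: tendsto_mono[OF inf_le1] filterlim_ident)
    moreover have "eventually (\<lambda>s. y + (s - c) *\<^sub>R ?q s = f s) ?F"
      by (auto simp: eventually_inf_principal)
    ultimately have "(f \<longlongrightarrow> y + (t - c) *\<^sub>R D) ?F"
      by (rule Lim_transform_eventually)
    then have "(f \<longlongrightarrow> f t) ?F"
      by (simp flip: D)
    then show "continuous (at t within S) f \<and> f t - y = (t - c) *\<^sub>R D"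
      using D by (simp add: eq continuous_within)
  next
    assume *: "continuous (at t within S) f \<and> f t - y = (t - c) *\<^sub>R D"
    then have "(f \<longlongrightarrow> f t) ?F" by (simp add: eq continuous_within)
    then have "(?q \<longlongrightarrow> (f t - y) /\<^sub>R (t - c)) ?F"
      using assms(2)
      by (intro tendsto_intros) (auto intro!: tendsto_mono[OF inf_le1] filterlim_ident)
    then show "(?q \<longlongrightarrow> D) ?F" using * assms(2) by simp
  qed
qed

text \<open>
  At a right-scattered point delta differentiability is continuity together with one jump equation;
  at any other point it is ordinary differentiability within \<open>T\<close>. The calculus rules
  for the delta derivative follow by this case distinction.
\<close>

lemma has_delta_deriv_iff:
  fixes u :: "real \<Rightarrow> 'a::real_normed_vector"
  assumes "t \<in> T"
  shows "has_delta_deriv T u D t \<longleftrightarrow>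
    (if sigma T t = t then (u has_vector_derivative D) (at t within T)
     else continuous (at t within T) u \<and> u (sigma T t) - u t = (sigma T t - t) *\<^sub>R D)"
proof -
  have "(u (sigma T t) - u s) /\<^sub>R (sigma T t - s) = (u s - u (sigma T t)) /\<^sub>R (s - sigma T t)" for s
    by (metis inverse_minus_eq minus_diff_eq scaleR_minus_left scaleR_minus_right)
  then have *: "has_delta_deriv T u D t \<longleftrightarrow>
      ((\<lambda>s. (u s - u (sigma T t)) /\<^sub>R (s - sigma T t)) \<longlongrightarrow> D)
       (inf (nhds t) (principal (T - {sigma T t})))"
    by (simp add: has_delta_deriv_def)
  show ?thesis
  proof (cases "sigma T t = t")
    case True
    then have "has_delta_deriv T u D t \<longleftrightarrow> ((\<lambda>s. (u s - u t) /\<^sub>R (s - t)) \<longlongrightarrow> D) (at t within T)"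
      unfolding * at_within_def by (simp only:)
    then show ?thesis using True by (simp add: has_vector_derivative_iff_quotient)
  next
    case False
    have "u t - u (sigma T t) = (t - sigma T t) *\<^sub>R D \<longleftrightarrow> u (sigma T t) - u t = (sigma T t - t) *\<^sub>R D"
      by (metis minus_diff_eq scaleR_minus_left)
    then show ?thesis
      using False unfolding * tendsto_difference_quotient_iff[OF assms False] by simp
  qed
qed

lemma has_nabla_deriv_iff:
  fixes f :: "real \<Rightarrow> 'a::real_normed_vector"
  assumes "t \<in> S"
  shows "has_nabla_deriv T S f D t \<longleftrightarrow>
    (if rho T t = t then (f has_vector_derivative D) (at t within S)
     else continuous (at t within S) f \<and> f t - f (rho T t) = (t - rho T t) *\<^sub>R D)"
proof (cases "rho T t = t")
  case True
  then have "has_nabla_deriv T S f D t \<longleftrightarrow> ((\<lambda>s. (f s - f t) /\<^sub>R (s - t)) \<longlongrightarrow> D) (at t within S)"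
    unfolding has_nabla_deriv_def at_within_def by (simp only:)
  then show ?thesis using True by (simp add: has_vector_derivative_iff_quotient)
next
  case False
  then show ?thesis
    using tendsto_difference_quotient_iff[OF assms False, of f "f (rho T t)" D]
    by (simp only: has_nabla_deriv_def if_False)
qed

text \<open>
  A mean value inequality that needs, at each point, only one step forward within the set along
  which the slope is almost at most \<open>M\<close>. The points reached from \<open>x\<close> with slope at most \<open>M + e\<close>
  form a compact set; from a maximum other than \<open>y\<close> a further step would lead to a larger point
  of this set.
\<close>

lemma norm_diff_le_of_forward_steps:
  fixes f :: "real \<Rightarrow> 'a::real_normed_vector"
  assumes S: "compact S" "x \<in> S" "y \<in> S" "x \<le> y"
    and cont: "continuous_on S f"
    and step: "\<And>t e. \<lbrakk>t \<in> S; x \<le> t; t < y; e > 0\<rbrakk> \<Longrightarrow>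
      \<exists>s\<in>S. t < s \<and> s \<le> y \<and> norm (f s - f t) \<le> (M + e) * (s - t)"
  shows "norm (f y - f x) \<le> M * (y - x)"
proof -
  have bound: "norm (f y - f x) \<le> (M + e) * (y - x)" if "e > 0" for e
  proof -
    define A where "A = {t \<in> S \<inter> {x..y}. norm (f t - f x) \<le> (M + e) * (t - x)}"
    have "compact (S \<inter> {x..y})" using S by (simp add: compact_Int)
    moreover have "closed A"
      unfolding A_def using cont S
      by (intro continuous_on_closed_Collect_le continuous_intros)
        (auto intro: continuous_on_subset compact_imp_closed)
    moreover have "A \<subseteq> S \<inter> {x..y}" by (auto simp: A_def)
    ultimately have "compact A" by (metis Int_absorb1 compact_Int_closed)
    moreover have "x \<in> A" using S by (simp add: A_def)
    ultimately obtain m where m: "m \<in> A" "\<And>t. t \<in> A \<Longrightarrow> t \<le> m"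
      using compact_attains_sup[of A] by auto
    have "m = y"
    proof (rule ccontr)
      assume "m \<noteq> y"
      then have "m < y" using m(1) by (auto simp: A_def)
      then obtain s where s: "s \<in> S" "m < s" "s \<le> y" "norm (f s - f m) \<le> (M + e) * (s - m)"
        using step[of m e] m(1) \<open>e > 0\<close> by (auto simp: A_def)
      have "norm (f s - f x) \<le> norm (f s - f m) + norm (f m - f x)"
        by (metis diff_add_cancel add_diff_eq norm_triangle_ineq)
      also have "\<dots> \<le> (M + e) * (s - m) + (M + e) * (m - x)"
        using s m(1) by (auto simp: A_def)
      also have "\<dots> = (M + e) * (s - x)" by (simp add: algebra_simps)
      finally have "s \<in> A" using s m(1) by (auto simp: A_def)
      then show False using m(2) s(2) by force
    qed
    then show ?thesis using m(1) by (simp add: A_def)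
  qed
  show ?thesis
  proof (cases "x = y")
    case False
    show ?thesis
    proof (rule field_le_epsilon)
      fix d :: real assume "d > 0"
      then have "norm (f y - f x) \<le> (M + d / (y - x)) * (y - x)"
        using False S(4) by (intro bound) simp
      then show "norm (f y - f x) \<le> M * (y - x) + d"
        using False by (simp only: distrib_right) simp
    qed
  qed simp
qed

section \<open>Jump operators of a compact time scale\<close>

locale compact_time_scale =
  fixes T :: "real set"
  assumes compact_T: "compact T" and nonempty: "T \<noteq> {}" and Inf_less_Sup: "Inf T < Sup T"
begin

abbreviation "\<sigma> \<equiv> sigma T"
abbreviation "\<rho> \<equiv> rho T"
abbreviation "K \<equiv> upper_kappa T"



lemma bdd: "bdd_above T" "bdd_below T"
  using compact_T by (auto intro: bounded_imp_bdd_above bounded_imp_bdd_below compact_imp_bounded)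

lemma Inf_in: "Inf T \<in> T" and Sup_in: "Sup T \<in> T"
  using closed_contains_Inf[of T] closed_contains_Sup[of T] compact_imp_closed[OF compact_T]
    nonempty bdd by blast+

lemma Inf_le: "t \<in> T \<Longrightarrow> Inf T \<le> t" and le_Sup: "t \<in> T \<Longrightarrow> t \<le> Sup T"
  using bdd by (auto intro: cInf_lower cSup_upper)

lemma sigma_Sup [simp]: "\<sigma> (Sup T) = Sup T"
proof -
  have "{s \<in> T. Sup T < s} = {}" using le_Sup by fastforce
  then show ?thesis by (simp add: sigma_def)
qed

lemma rho_Inf [simp]: "\<rho> (Inf T) = Inf T"
proof -
  have "{s \<in> T. s < Inf T} = {}" using Inf_le by fastforce
  then show ?thesis by (simp add: rho_def)
qed

lemma sigma_eq_Inf: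
  assumes "t \<in> T" "t < Sup T"
  shows "\<sigma> t = Inf {s \<in> T. t < s}" "{s \<in> T. t < s} \<noteq> {}" "bdd_below {s \<in> T. t < s}"
proof -
  show ne: "{s \<in> T. t < s} \<noteq> {}" using assms Sup_in by blast
  then show "\<sigma> t = Inf {s \<in> T. t < s}" by (simp only: sigma_def if_False)
  show "bdd_below {s \<in> T. t < s}" by (rule bdd_below_mono[OF bdd(2)]) auto
qed

lemma rho_eq_Sup:
  assumes "t \<in> T" "Inf T < t"
  shows "\<rho> t = Sup {s \<in> T. s < t}" "{s \<in> T. s < t} \<noteq> {}" "bdd_above {s \<in> T. s < t}"
proof -
  show ne: "{s \<in> T. s < t} \<noteq> {}" using assms Inf_in by blast
  then show "\<rho> t = Sup {s \<in> T. s < t}" by (simp only: rho_def if_False)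
  show "bdd_above {s \<in> T. s < t}" by (rule bdd_above_mono[OF bdd(1)]) auto
qed

lemma sigma_ge: "t \<in> T \<Longrightarrow> t \<le> \<sigma> t"
  using le_Sup[of t] sigma_eq_Inf[of t] by (cases "t = Sup T") (auto intro!: cInf_greatest)

lemma rho_le: "t \<in> T \<Longrightarrow> \<rho> t \<le> t"
  using Inf_le[of t] rho_eq_Sup[of t] by (cases "t = Inf T") (auto intro!: cSup_least)

lemma sigma_le: "t \<in> T \<Longrightarrow> s \<in> T \<Longrightarrow> t < s \<Longrightarrow> \<sigma> t \<le> s"
  using le_Sup[of s] sigma_eq_Inf[of t] by (auto intro!: cInf_lower)

lemma rho_ge: "t \<in> T \<Longrightarrow> s \<in> T \<Longrightarrow> s < t \<Longrightarrow> s \<le> \<rho> t"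
  using Inf_le[of s] rho_eq_Sup[of t] by (auto intro!: cSup_upper)

lemma sigma_in [simp]: "t \<in> T \<Longrightarrow> \<sigma> t \<in> T"
proof (cases "t = Sup T")
  case False
  assume t: "t \<in> T"
  then have "t < Sup T" using False le_Sup by fastforce
  then have "\<sigma> t \<in> closure {s \<in> T. t < s}"
    using sigma_eq_Inf[OF t] closure_contains_Inf[of "{s \<in> T. t < s}"] by simp
  also have "\<dots> \<subseteq> T" using compact_T by (intro closure_minimal) (auto intro: compact_imp_closed)
  finally show ?thesis .
qed (simp add: Sup_in)

lemma rho_in [simp]: "t \<in> T \<Longrightarrow> \<rho> t \<in> T"
proof (cases "t = Inf T")
  case False
  assume t: "t \<in> T"
  then have "Inf T < t" using False Inf_le by fastforce
  then have "\<rho> t \<in> closure {s \<in> T. s < t}"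
    using rho_eq_Sup[OF t] closure_contains_Sup[of "{s \<in> T. s < t}"] by simp
  also have "\<dots> \<subseteq> T" using compact_T by (intro closure_minimal) (auto intro: compact_imp_closed)
  finally show ?thesis .
qed (simp add: Inf_in)

lemma sigma_approx:
  assumes "t \<in> T" "t < Sup T" "\<sigma> t = t" "t < r"
  obtains s where "s \<in> T" "t < s" "s < r"
  using cInf_lessD[of "{s \<in> T. t < s}" r] sigma_eq_Inf[of t] assms by auto

lemma rho_approx:
  assumes "t \<in> T" "Inf T < t" "\<rho> t = t" "r < t"
  obtains s where "s \<in> T" "r < s" "s < t"
  using less_cSupD[of "{s \<in> T. s < t}" r] rho_eq_Sup[of t] assms by auto

lemma sigma_rho:
  assumes "t \<in> T" "\<rho> t < t"
  shows "\<sigma> (\<rho> t) = t"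
proof (rule antisym)
  show "\<sigma> (\<rho> t) \<le> t" using assms by (intro sigma_le) auto
  show "t \<le> \<sigma> (\<rho> t)"
  proof (rule ccontr)
    assume "\<not> t \<le> \<sigma> (\<rho> t)"
    then have "\<sigma> (\<rho> t) \<le> \<rho> t" using assms by (intro rho_ge) auto
    then have "\<sigma> (\<rho> t) = \<rho> t" using assms sigma_ge[of "\<rho> t"] by simp
    then obtain s where "s \<in> T" "\<rho> t < s" "s < t"
      using sigma_approx[of "\<rho> t" t] assms le_Sup[of t] by auto
    then show False using rho_ge[of t s] assms by simp
  qed
qed

lemma mem_K_iff: "t \<in> K \<longleftrightarrow> t \<in> T \<and> (t < Sup T \<or> \<rho> (Sup T) = Sup T)"
  unfolding upper_kappa_def
  using rho_ge[OF Sup_in, of t] rho_le[OF Sup_in] le_Sup[of t] Sup_in by fastforce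

lemma mem_lower_kappa_iff: "t \<in> lower_kappa T \<longleftrightarrow> t \<in> T \<and> (Inf T < t \<or> \<sigma> (Inf T) = Inf T)"
  unfolding lower_kappa_def
  using sigma_le[OF Inf_in, of t] sigma_ge[OF Inf_in] Inf_le[of t] Inf_in by fastforce

lemma K_subset: "K \<subseteq> T" by (simp add: upper_kappa_def)

lemma Inf_in_K: "Inf T \<in> K" using Inf_in Inf_less_Sup by (simp add: mem_K_iff)

lemma K_eq: "K = T \<inter> {..\<rho> (Sup T)}"
  using le_Sup by (force simp: upper_kappa_def)

lemma compact_K: "compact K"
  using compact_T by (simp add: K_eq compact_Int_closed)

lemma islimpt_of_right_dense:
  assumes "t \<in> T" "t < Sup T" "\<sigma> t = t"
  shows "t islimpt T"
  unfolding islimpt_approachable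
proof (intro allI impI)
  fix e :: real assume "0 < e"
  then obtain s where "s \<in> T" "t < s" "s < t + e"
    using sigma_approx[of t "t + e"] assms by auto
  then show "\<exists>s\<in>T. s \<noteq> t \<and> dist s t < e" by (intro bexI[of _ s]) (auto simp: dist_real_def)
qed

lemma islimpt_of_left_dense:
  assumes "t \<in> T" "Inf T < t" "\<rho> t = t"
  shows "t islimpt T"
  unfolding islimpt_approachable
proof (intro allI impI)
  fix e :: real assume "0 < e"
  then obtain s where "s \<in> T" "t - e < s" "s < t"
    using rho_approx[of t "t - e"] assms by auto
  then show "\<exists>s\<in>T. s \<noteq> t \<and> dist s t < e" by (intro bexI[of _ s]) (auto simp: dist_real_def)
qed

lemma islimpt_K: "t \<in> K \<Longrightarrow> \<sigma> t = t \<Longrightarrow> t islimpt T"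
  using islimpt_of_right_dense[of t] islimpt_of_left_dense[of t] Inf_less_Sup le_Sup[of t]
  unfolding mem_K_iff by (cases "t = Sup T") auto

text \<open>
  Points scattered on both sides are isolated, where the end points count as scattered on the side
  that has no points of \<open>T\<close>.
\<close>

lemma at_within_eq_bot:
  assumes "t \<in> T" "t = Inf T \<or> \<rho> t < t" "t = Sup T \<or> t < \<sigma> t"
  shows "at t within T = bot"
proof -
  define e where "e = min (if t = Inf T then 1 else t - \<rho> t) (if t = Sup T then 1 else \<sigma> t - t)"
  have "e > 0" using assms by (auto simp: e_def)
  moreover have "s = t" if "s \<in> T" "dist s t < e" for s
    using that rho_ge[OF assms(1), of s] sigma_le[OF assms(1), of s] Inf_le[of s] le_Sup[of s]
    by (cases s t rule: linorder_cases) (auto simp: e_def dist_real_def split: if_splits)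
  ultimately have "\<not> t islimpt T" unfolding islimpt_approachable by blast
  then show ?thesis by (simp add: trivial_limit_within)
qed

end

section \<open>The delta derivative\<close>

context compact_time_scale
begin

lemma sigma_gt_iff: "t \<in> T \<Longrightarrow> \<sigma> t \<noteq> t \<longleftrightarrow> t < \<sigma> t"
  using sigma_ge[of t] by auto

lemma rho_lt_iff: "t \<in> T \<Longrightarrow> \<rho> t \<noteq> t \<longleftrightarrow> \<rho> t < t"
  using rho_le[of t] by auto

lemma delta_deriv_continuous:
  fixes f :: "real \<Rightarrow> 'a::real_normed_vector"
  assumes "t \<in> T" "has_delta_deriv T f D t"
  shows "continuous (at t within T) f"
  using assms by (auto simp: has_delta_deriv_iff has_vector_derivative_continuous split: if_splits)

lemma delta_differentiable_continuous_on:
  fixes f :: "real \<Rightarrow> 'a::real_normed_vector"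
  assumes "\<And>t. t \<in> K \<Longrightarrow> \<exists>D. has_delta_deriv T f D t"
  shows "continuous_on T f"
  unfolding continuous_on_eq_continuous_within
proof
  fix t assume t: "t \<in> T"
  show "continuous (at t within T) f"
  proof (cases "t \<in> K")
    case True
    then show ?thesis using assms[OF True] delta_deriv_continuous[OF t] by blast
  next
    case False
    then have "t = Sup T" "\<rho> (Sup T) < Sup T"
      using t le_Sup[of t] rho_le[OF Sup_in] by (auto simp: mem_K_iff)
    then show ?thesis using at_within_eq_bot[OF t] by simp
  qed
qed

lemma delta_deriv_jump:
  fixes f :: "real \<Rightarrow> 'a::real_normed_vector"
  assumes "t \<in> T" "has_delta_deriv T f D t"
  shows "f (\<sigma> t) - f t = (\<sigma> t - t) *\<^sub>R D"
  using assms by (auto simp: has_delta_deriv_iff split: if_splits)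

lemma has_delta_deriv_unique:
  fixes f :: "real \<Rightarrow> 'a::real_normed_vector"
  assumes "t \<in> K" "has_delta_deriv T f D t" "has_delta_deriv T f D' t"
  shows "D = D'"
proof (cases "\<sigma> t = t")
  case True
  have "\<not> trivial_limit (at t within T)"
    using islimpt_K[OF assms(1) True] by (simp add: trivial_limit_within)
  then show ?thesis
    using assms True K_subset vector_derivative_unique_within[of t T f D D'] subsetD[of K T t]
    by (simp add: has_delta_deriv_iff)
next
  case False
  then show ?thesis
    using assms delta_deriv_jump[of t f D] delta_deriv_jump[of t f D'] K_subset subsetD[of K T t]
    by auto
qed

lemma delta_deriv_eq:
  fixes f :: "real \<Rightarrow> 'a::real_normed_vector"
  assumes "t \<in> K" "has_delta_deriv T f D t"
  shows "delta_deriv T f t = D"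
  unfolding delta_deriv_def using assms has_delta_deriv_unique[OF assms(1)] by blast

lemma has_delta_deriv_bounded_linear:
  assumes "bounded_linear h" "t \<in> T" "has_delta_deriv T f D t"
  shows "has_delta_deriv T (\<lambda>s. h (f s)) (h D) t"
proof -
  interpret bounded_linear h by fact
  show ?thesis
    using assms(2,3) by (auto simp: has_delta_deriv_iff has_vector_derivative continuous
        diff[symmetric] scaleR[symmetric] simp del: diff scaleR split: if_splits)
qed

lemma has_delta_deriv_add:
  fixes f g :: "real \<Rightarrow> 'a::real_normed_vector"
  assumes "t \<in> T" "has_delta_deriv T f D t" "has_delta_deriv T g E t"
  shows "has_delta_deriv T (\<lambda>s. f s + g s) (D + E) t"
proof (cases "\<sigma> t = t")
  case False
  have "f (\<sigma> t) + g (\<sigma> t) - (f t + g t) = (f (\<sigma> t) - f t) + (g (\<sigma> t) - g t)"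
    by simp
  also have "\<dots> = (\<sigma> t - t) *\<^sub>R (D + E)"
    using assms by (simp add: delta_deriv_jump scaleR_add_right)
  finally show ?thesis
    using False assms delta_deriv_continuous[OF assms(1)]
    by (auto simp: has_delta_deriv_iff[OF assms(1)] intro!: continuous_add split: if_splits)
qed (use assms in \<open>auto simp: has_delta_deriv_iff intro: has_vector_derivative_add\<close>)

lemma has_delta_deriv_const: "t \<in> T \<Longrightarrow> has_delta_deriv T (\<lambda>s. c) 0 t"
  by (simp add: has_delta_deriv_iff)

lemma has_delta_deriv_ident: "t \<in> T \<Longrightarrow> has_delta_deriv T (\<lambda>s. s) 1 t"
  by (simp add: has_delta_deriv_iff)

lemma has_delta_deriv_scaleR:
  "t \<in> T \<Longrightarrow> has_delta_deriv T f D t \<Longrightarrow> has_delta_deriv T (\<lambda>s. c *\<^sub>R f s) (c *\<^sub>R D) t"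
  by (rule has_delta_deriv_bounded_linear[OF bounded_linear_scaleR_right])

lemma has_delta_deriv_diff:
  fixes f g :: "real \<Rightarrow> 'a::real_normed_vector"
  assumes "t \<in> T" "has_delta_deriv T f D t" "has_delta_deriv T g E t"
  shows "has_delta_deriv T (\<lambda>s. f s - g s) (D - E) t"
  using has_delta_deriv_add[OF assms(1,2) has_delta_deriv_scaleR[OF assms(1,3), of "-1"]] by simp

text \<open>
  The second factor is taken at \<open>t\<close> and the first at \<open>\<sigma> t\<close>. This asymmetric splitting of the
  increment is what makes \<open>P \<circ> \<sigma>\<close> rather than \<open>P\<close> appear after integration by parts.
\<close>

lemma has_delta_deriv_inner:
  fixes f g :: "real \<Rightarrow> 'a::real_inner"
  assumes "t \<in> T" "has_delta_deriv T f D t" "has_delta_deriv T g E t"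
  shows "has_delta_deriv T (\<lambda>s. f s \<bullet> g s) (D \<bullet> g t + f (\<sigma> t) \<bullet> E) t"
proof (cases "\<sigma> t = t")
  case True
  then show ?thesis
    using assms bounded_bilinear.has_vector_derivative[OF bounded_bilinear_inner, of f D t T g E]
    by (simp add: has_delta_deriv_iff add.commute)
next
  case False
  have "f (\<sigma> t) \<bullet> g (\<sigma> t) - f t \<bullet> g t
      = (f (\<sigma> t) - f t) \<bullet> g t + f (\<sigma> t) \<bullet> (g (\<sigma> t) - g t)"
    by (simp add: inner_diff_left inner_diff_right)
  also have "\<dots> = (\<sigma> t - t) * (D \<bullet> g t + f (\<sigma> t) \<bullet> E)"
    using assms by (simp add: delta_deriv_jump distrib_left)
  finally show ?thesis
    using False assms delta_deriv_continuous[OF assms(1)]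
    by (auto simp: has_delta_deriv_iff[OF assms(1)] intro!: continuous_inner split: if_splits)
qed

lemma has_vector_derivative_step:
  fixes f :: "real \<Rightarrow> 'a::real_normed_vector"
  assumes "(f has_vector_derivative D) (at t within S)" "e > 0"
  obtains d where "d > 0" "\<And>s. s \<in> S \<Longrightarrow> \<bar>s - t\<bar> < d \<Longrightarrow> norm (f s - f t) \<le> (norm D + e) * \<bar>s - t\<bar>"
proof -
  obtain d where d: "d > 0"
      "\<And>s. s \<in> S \<Longrightarrow> norm (s - t) < d \<Longrightarrow> norm (f s - f t - (s - t) *\<^sub>R D) \<le> e * norm (s - t)"
    using assms unfolding has_vector_derivative_def has_derivative_within_alt by blast
  have "norm (f s - f t) \<le> (norm D + e) * \<bar>s - t\<bar>" if "s \<in> S" "\<bar>s - t\<bar> < d" for s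
  proof -
    have "norm (f s - f t) \<le> norm ((s - t) *\<^sub>R D) + norm (f s - f t - (s - t) *\<^sub>R D)"
      by (rule norm_triangle_sub)
    also have "\<dots> \<le> \<bar>s - t\<bar> * norm D + e * \<bar>s - t\<bar>" using d(2)[of s] that by simp
    finally show ?thesis by (simp add: algebra_simps)
  qed
  then show thesis using that d(1) by blast
qed

text \<open>
  The forward step is to \<open>\<sigma> t\<close> at a right-scattered point and to a nearby point of \<open>T\<close> otherwise.
\<close>

lemma delta_mean_value:
  fixes f :: "real \<Rightarrow> 'a::real_normed_vector"
  assumes "x \<in> T" "y \<in> T" "x \<le> y" "continuous_on T f"
    and "\<And>t. \<lbrakk>t \<in> T; x \<le> t; t < y\<rbrakk> \<Longrightarrow> \<exists>D. has_delta_deriv T f D t \<and> norm D \<le> M"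
  shows "norm (f y - f x) \<le> M * (y - x)"
proof (rule norm_diff_le_of_forward_steps[OF compact_T assms(1-4)])
  fix t e :: real assume t: "t \<in> T" "x \<le> t" "t < y" and e: "e > 0"
  obtain D where D: "has_delta_deriv T f D t" "norm D \<le> M" using assms(5) t by blast
  show "\<exists>s\<in>T. t < s \<and> s \<le> y \<and> norm (f s - f t) \<le> (M + e) * (s - t)"
  proof (cases "\<sigma> t = t")
    case True
    then obtain d where d: "d > 0"
      "\<And>s. s \<in> T \<Longrightarrow> \<bar>s - t\<bar> < d \<Longrightarrow> norm (f s - f t) \<le> (norm D + e) * \<bar>s - t\<bar>"
      using has_vector_derivative_step[of f D t T e] D(1) e t(1) by (auto simp: has_delta_deriv_iff)
    obtain s where s: "s \<in> T" "t < s" "s < min y (t + d)"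
      using sigma_approx[of t "min y (t + d)"] True t d(1) le_Sup[OF assms(2)] by auto
    have "norm (f s - f t) \<le> (norm D + e) * (s - t)" using d(2)[of s] s by auto
    also have "\<dots> \<le> (M + e) * (s - t)" using D(2) s by (intro mult_right_mono) auto
    finally show ?thesis using s by (intro bexI[of _ s]) auto
  next
    case False
    then have s: "\<sigma> t \<in> T" "t < \<sigma> t" "\<sigma> t \<le> y"
      using t assms(2) sigma_le[of t y] sigma_gt_iff by auto
    have "norm (f (\<sigma> t) - f t) = (\<sigma> t - t) * norm D"
      using delta_deriv_jump[OF t(1) D(1)] s by simp
    also have "\<dots> \<le> (M + e) * (\<sigma> t - t)"
      using D(2) s e by (subst mult.commute) (intro mult_right_mono, auto)
    finally show ?thesis using s by blast
  qed
qed

lemma mem_K_if_less: "t \<in> T \<Longrightarrow> t < s \<Longrightarrow> s \<in> T \<Longrightarrow> t \<in> K"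
  using le_Sup[of s] by (simp add: mem_K_iff)

lemma delta_constant:
  fixes f :: "real \<Rightarrow> 'a::real_normed_vector"
  assumes "\<And>t. t \<in> K \<Longrightarrow> has_delta_deriv T f 0 t" "t \<in> T"
  shows "f t = f (Inf T)"
  using delta_mean_value[of "Inf T" t f 0] assms Inf_in Inf_le mem_K_if_less[of _ t]
    delta_differentiable_continuous_on[of f]
  by force

lemma delta_integral_eq:
  fixes F :: "real \<Rightarrow> 'a::real_normed_vector"
  assumes "\<And>s. s \<in> K \<Longrightarrow> has_delta_deriv T F (f s) s" "t \<in> T"
  shows "delta_integral T f t = F t - F (Inf T)"
  unfolding delta_integral_def
proof (rule the_equality)
  have "has_delta_deriv T (\<lambda>s. F s - F (Inf T)) (f s) s" if "s \<in> K" for s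
    using has_delta_deriv_diff[OF _ assms(1)[OF that] has_delta_deriv_const[of s "F (Inf T)"]]
      that K_subset by auto
  then show "\<exists>G. (\<forall>s\<in>K. has_delta_deriv T G (f s) s) \<and> G (Inf T) = 0 \<and> G t = F t - F (Inf T)"
    by (intro exI[of _ "\<lambda>s. F s - F (Inf T)"]) auto
next
  fix y assume "\<exists>G. (\<forall>s\<in>K. has_delta_deriv T G (f s) s) \<and> G (Inf T) = 0 \<and> G t = y"
  then obtain G where G: "\<And>s. s \<in> K \<Longrightarrow> has_delta_deriv T G (f s) s" "G (Inf T) = 0" "G t = y"
    by blast
  have "has_delta_deriv T (\<lambda>s. G s - F s) 0 s" if "s \<in> K" for s
    using has_delta_deriv_diff[OF _ G(1)[OF that] assms(1)[OF that]] that K_subset by auto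
  then have "G t - F t = G (Inf T) - F (Inf T)" using assms(2) by (rule delta_constant)
  then show "y = F t - F (Inf T)" using G by (simp add: algebra_simps)
qed

lemma delta_integral_cong:
  "(\<And>s. s \<in> K \<Longrightarrow> f s = g s) \<Longrightarrow> delta_integral T f t = delta_integral T g t"
  by (simp add: delta_integral_def)

end

section \<open>Existence of antiderivatives\<close>

context compact_time_scale
begin

text \<open>
  For \<open>s\<close> between \<open>Inf T\<close> and \<open>Sup T\<close> this is the last point of \<open>T\<close> up to \<open>s\<close>. Inserting \<open>Inf T\<close>
  makes the set nonempty for every real \<open>s\<close>, so that the function is monotone on the whole line and
  hence Borel measurable.
\<close>

definition floor_T :: "real \<Rightarrow> real" where
  "floor_T s = Sup (insert (Inf T) (T \<inter> {..s}))"

lemma bdd_floor_set: "bdd_above (insert (Inf T) (T \<inter> {..s}))"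
  using bdd(1) by (simp add: bdd_above_Int1)

lemma mono_floor_T: "mono floor_T"
  unfolding floor_T_def by (intro monoI cSup_subset_mono bdd_floor_set) auto

lemma floor_T_in: "floor_T s \<in> T"
proof -
  have "closed (insert (Inf T) (T \<inter> {..s}))"
    using compact_T by (intro closed_insert closed_Int) (auto intro: compact_imp_closed)
  then have "floor_T s \<in> insert (Inf T) (T \<inter> {..s})"
    unfolding floor_T_def by (intro closed_contains_Sup bdd_floor_set) auto
  then show ?thesis using Inf_in by auto
qed

lemma floor_T_ge: "t \<in> T \<Longrightarrow> t \<le> s \<Longrightarrow> t \<le> floor_T s"
  unfolding floor_T_def by (intro cSup_upper bdd_floor_set) auto

lemma floor_T_le: "Inf T \<le> s \<Longrightarrow> floor_T s \<le> s"
  unfolding floor_T_def by (intro cSup_least) auto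

lemma floor_T_eq:
  assumes "t \<in> T" "t \<le> s" "s < \<sigma> t"
  shows "floor_T s = t"
proof (rule antisym)
  show "floor_T s \<le> t"
  proof (rule ccontr)
    assume "\<not> floor_T s \<le> t"
    then have "\<sigma> t \<le> floor_T s" using assms floor_T_in sigma_le[of t "floor_T s"] by auto
    also have "\<dots> \<le> s" using assms Inf_le[of t] by (intro floor_T_le) auto
    finally show False using assms by simp
  qed
qed (rule floor_T_ge[OF assms(1,2)])

lemma floor_T_integrable:
  fixes g :: "real \<Rightarrow> 'a::euclidean_space"
  assumes "continuous_on UNIV g"
  shows "(\<lambda>s. g (floor_T s)) integrable_on {x..y}"
proof -
  have "compact (g ` T)"
    using assms compact_T by (intro compact_continuous_image) (auto intro: continuous_on_subset)
  then obtain B where B: "\<And>t. t \<in> T \<Longrightarrow> norm (g t) \<le> B"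
    using compact_imp_bounded bounded_iff by (metis imageI)
  have "g \<circ> floor_T \<in> borel_measurable borel"
    using borel_measurable_continuous_onI[OF assms] borel_measurable_mono[OF mono_floor_T]
    by (rule measurable_comp[rotated])
  then have "set_integrable lborel {x..y} (\<lambda>s. g (floor_T s))"
    unfolding set_integrable_def
    by (intro integrableI_bounded_set_indicator[where B = B]) (auto simp: B floor_T_in o_def emeasure_lborel_Icc_eq)
  then show ?thesis by (rule set_borel_integral_eq_integral)
qed

text \<open>
  The ordinary integral of \<open>g \<circ> floor_T\<close>, with \<open>g\<close> a continuous extension of \<open>f\<close> to the reals, has
  the required derivative. On a gap \<open>[t, \<sigma> t)\<close> the integrand is constantly \<open>g t\<close>, which gives the
  jump equation; near a point that is not right-scattered its values between two points of \<open>T\<close> are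
  values of \<open>g\<close> between the same two points, so continuity of \<open>g\<close> gives the derivative.
  The extension is needed because \<open>Sup T\<close> is a value of \<open>floor_T\<close> but need not lie in \<open>K\<close>.
\<close>

lemma antiderivative_exists:
  fixes f :: "real \<Rightarrow> 'a::euclidean_space"
  assumes "continuous_on K f"
  obtains F where "\<And>t. t \<in> K \<Longrightarrow> has_delta_deriv T F (f t) t" "F (Inf T) = 0"
proof -
  have "closedin (top_of_set UNIV) K" using compact_K by (simp add: compact_imp_closed)
  then obtain g where g: "continuous_on UNIV g" "\<And>t. t \<in> K \<Longrightarrow> g t = f t"
    using Tietze_unbounded[OF assms] by metis
  define h where "h s = g (floor_T s)" for s
  have int: "h integrable_on {x..y}" for x y
    unfolding h_def by (rule floor_T_integrable[OF g(1)])
  define F where "F t = integral {Inf T..t} h" for t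
  have F_diff: "F y - F x = integral {x..y} h" if "x \<in> T" "x \<le> y" for x y
    using Henstock_Kurzweil_Integration.integral_combine[OF Inf_le[OF that(1)] that(2) int] by (simp add: F_def algebra_simps)
  have close: "norm (F y - F x - (y - x) *\<^sub>R c) \<le> e * (y - x)"
    if xy: "x \<in> T" "y \<in> T" "x \<le> y" and e: "0 \<le> e"
      and bound: "\<And>r. r \<in> T \<Longrightarrow> x \<le> r \<Longrightarrow> r \<le> y \<Longrightarrow> norm (g r - c) \<le> e" for x y c e
  proof -
    have "((\<lambda>r. h r - c) has_integral (F y - F x - (y - x) *\<^sub>R c)) (cbox x y)"
      using has_integral_diff[OF integrable_integral[OF int] has_integral_const_real[of c x y]] xy
      by (simp add: F_diff)
    moreover have "norm (h r - c) \<le> e" if "r \<in> cbox x y" for r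
      unfolding h_def using that xy Inf_le[OF xy(1)] floor_T_in floor_T_ge[OF xy(1)] floor_T_le[of r]
      by (intro bound) force+
    ultimately have "norm (F y - F x - (y - x) *\<^sub>R c) \<le> e * measure lborel (cbox x y)"
      by (rule has_integral_bound[OF e])
    then show ?thesis using xy by simp
  qed
  have "has_delta_deriv T F (g t) t" if "t \<in> K" for t
  proof -
    have t: "t \<in> T" using that K_subset by auto
    show ?thesis
    proof (cases "\<sigma> t = t")
      case True
      have "(F has_vector_derivative g t) (at t within T)"
        unfolding has_vector_derivative_def has_derivative_within_alt
      proof (intro conjI allI impI)
        fix e :: real assume e: "0 < e"
        have "isCont g t" using g(1) by (simp add: continuous_on_eq_continuous_at)
        then obtain d where d: "d > 0" "\<And>s. \<bar>s - t\<bar> < d \<Longrightarrow> norm (g s - g t) < e"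
          using e unfolding continuous_at_eps_delta dist_norm real_norm_def by metis
        have "norm (F s - F t - (s - t) *\<^sub>R g t) \<le> e * norm (s - t)"
          if s: "s \<in> T" "norm (s - t) < d" for s
        proof (cases "t \<le> s")
          case True
          have "norm (F s - F t - (s - t) *\<^sub>R g t) \<le> e * (s - t)"
            using t s True e by (intro close) (auto intro!: less_imp_le[OF d(2)])
          then show ?thesis using True by simp
        next
          case False
          have "norm (F t - F s - (t - s) *\<^sub>R g t) \<le> e * (t - s)"
            using t s False e by (intro close) (auto intro!: less_imp_le[OF d(2)])
          moreover have "norm (F s - F t - (s - t) *\<^sub>R g t) = norm (F t - F s - (t - s) *\<^sub>R g t)"
            by (subst norm_minus_cancel[symmetric]) (simp add: algebra_simps)
          ultimately show ?thesis using False by simp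
        qed
        then show "\<exists>d>0. \<forall>s\<in>T. norm (s - t) < d \<longrightarrow>
            norm (F s - F t - (s - t) *\<^sub>R g t) \<le> e * norm (s - t)"
          using d(1) by blast
      qed (rule bounded_linear_scaleR_left)
      then show ?thesis using True t by (simp add: has_delta_deriv_iff)
    next
      case False
      have "continuous_on {Inf T..Sup T} F"
        unfolding F_def by (rule indefinite_integral_continuous_1[OF int])
      then have "continuous_on T F"
        by (rule continuous_on_subset) (auto intro: Inf_le le_Sup)
      moreover have "(h has_integral (\<sigma> t - t) *\<^sub>R g t) {t..\<sigma> t}"
      proof (rule has_integral_spike_finite[of "{\<sigma> t}" _ _ "\<lambda>_. g t"])
        show "h r = g t" if "r \<in> {t..\<sigma> t} - {\<sigma> t}" for r
          using that floor_T_eq[OF t, of r] by (simp add: h_def)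
        show "((\<lambda>_. g t) has_integral (\<sigma> t - t) *\<^sub>R g t) {t..\<sigma> t}"
          using has_integral_const_real[of "g t" t "\<sigma> t"] sigma_ge[OF t] by simp
      qed simp
      then have "F (\<sigma> t) - F t = (\<sigma> t - t) *\<^sub>R g t"
        using F_diff[OF t sigma_ge[OF t]] by (simp add: integral_unique)
      ultimately show ?thesis
        using False t by (simp add: has_delta_deriv_iff continuous_on_eq_continuous_within)
    qed
  qed
  then show thesis using that[of F] g(2) by (simp add: F_def)
qed

end

section \<open>Time scales with nabla differentiable forward jump\<close>

locale sigma_nabla_time_scale = compact_time_scale +
  assumes sigma_nabla: "\<And>t. t \<in> lower_kappa T \<Longrightarrow> \<exists>D. has_nabla_deriv T T (sigma T) D t"
begin

lemma sigma_continuous: "continuous_on T \<sigma>"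
  unfolding continuous_on_eq_continuous_within
proof
  fix t assume t: "t \<in> T"
  show "continuous (at t within T) \<sigma>"
  proof (cases "t \<in> lower_kappa T")
    case True
    then show ?thesis
      using sigma_nabla[OF True] t has_vector_derivative_continuous
      by (auto simp: has_nabla_deriv_iff split: if_splits)
  next
    case False
    then have "t = Inf T" "Inf T < \<sigma> (Inf T)"
      using t Inf_le[of t] sigma_ge[OF Inf_in] by (auto simp: mem_lower_kappa_iff)
    then show ?thesis using at_within_eq_bot[OF t] by simp
  qed
qed

text \<open>
  Points \<open>s < t\<close> of \<open>T\<close> satisfy \<open>\<sigma> s \<le> t\<close>. If \<open>t\<close> is left-dense, then letting \<open>s\<close> tend to \<open>t\<close> in
  the continuous function \<open>\<sigma>\<close> yields \<open>\<sigma> t \<le> t\<close>.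
\<close>

lemma sigma_eq_if_left_dense:
  assumes "t \<in> T" "Inf T < t" "\<rho> t = t"
  shows "\<sigma> t = t"
proof (rule ccontr)
  assume ne: "\<sigma> t \<noteq> t"
  then have "t < \<sigma> t" using assms(1) sigma_gt_iff by blast
  moreover have "(\<sigma> \<longlongrightarrow> \<sigma> t) (at t within T)"
    using sigma_continuous assms(1) by (simp add: continuous_on_def)
  ultimately have "eventually (\<lambda>s. t < \<sigma> s) (at t within T)" using order_tendstoD(1) by blast
  then obtain d where d: "d > 0" "\<And>s. \<lbrakk>s \<in> T; s \<noteq> t; dist s t < d\<rbrakk> \<Longrightarrow> t < \<sigma> s"
    unfolding eventually_at by blast
  obtain s where s: "s \<in> T" "t - d < s" "s < t"
    using rho_approx[OF assms, of "t - d"] d(1) by auto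
  then have "t < \<sigma> s" by (intro d(2)) (auto simp: dist_real_def)
  moreover have "\<sigma> s \<le> t" using s assms(1) by (intro sigma_le) auto
  ultimately show False by simp
qed

lemma sigma_eq_if_rho_eq:
  assumes "t \<in> lower_kappa T" "\<rho> t = t"
  shows "\<sigma> t = t"
  using assms sigma_eq_if_left_dense[of t] Inf_le[of t]
  by (cases "t = Inf T") (auto simp: mem_lower_kappa_iff)

text \<open>
  The point that needs an argument is a left-dense \<open>Sup T\<close>, where rd-continuity provides a
  left limit \<open>l\<close> of the derivative but does not relate it to the derivative at \<open>Sup T\<close>. As
  for an ordinary derivative, the mean value inequality applied to \<open>u t - t *\<^sub>R l\<close> shows
  that the difference quotients at \<open>Sup T\<close> also tend to \<open>l\<close>.
\<close>

lemma C1rd_continuous: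
  assumes "u \<in> C1rd T"
  shows "continuous_on K (delta_deriv T u)"
  unfolding continuous_on_eq_continuous_within
proof
  define v where "v = delta_deriv T u"
  have rd: "rd_continuous_on T K v" and ex: "\<And>t. t \<in> K \<Longrightarrow> \<exists>D. has_delta_deriv T u D t"
    using assms by (auto simp: C1rd_def v_def)
  have deriv: "has_delta_deriv T u (v t) t" if "t \<in> K" for t
    using ex[OF that] delta_deriv_eq[OF that] by (auto simp: v_def)
  have contu: "continuous_on T u" by (rule delta_differentiable_continuous_on[OF ex])
  fix t assume tK: "t \<in> K"
  then have t: "t \<in> T" using K_subset by auto
  consider "right_dense T t" | "t = Sup T" "left_dense T t" | "t = Inf T \<or> \<rho> t < t" "t < \<sigma> t"
    | "t = Sup T" "\<rho> t < t"
    using sigma_eq_if_left_dense[OF t] rho_lt_iff[OF t] sigma_gt_iff[OF t] Inf_le[OF t]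
      Inf_less_Sup unfolding right_dense_def left_dense_def
    by (cases "t = Sup T"; cases "t = Inf T"; cases "\<rho> t = t"; cases "\<sigma> t = t") auto
  then have "continuous (at t within K) v"
  proof cases
    case 1
    then show ?thesis using rd tK by (simp add: rd_continuous_on_def)
  next
    case 3
    then have "at t within T = bot" using at_within_eq_bot[OF t] by auto
    then have "at t within K = bot" using at_le[OF K_subset, of t] by (simp add: bot.extremum_unique)
    then show ?thesis by simp
  next
    case 4
    then show ?thesis using tK by (simp add: mem_K_iff)
  next
    case 2
    then have K: "K = T" "Inf T < t" "\<rho> t = t"
      using Inf_less_Sup by (auto simp: mem_K_iff left_dense_def)
    obtain l where l: "(v \<longlongrightarrow> l) (at t within K \<inter> {..<t})"
      using rd tK 2 by (auto simp: rd_continuous_on_def)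
    have "K \<inter> {..<t} - {t} = K - {t}"
      using le_Sup 2 K_subset by force
    then have "at t within K \<inter> {..<t} = at t within K"
      unfolding at_within_def by simp
    then have l: "(v \<longlongrightarrow> l) (at t within T)" using l K by simp
    have "norm (v t - l) \<le> e" if "e > 0" for e
    proof -
      obtain d where d: "d > 0" "\<And>s. \<lbrakk>s \<in> T; s \<noteq> t; dist s t < d\<rbrakk> \<Longrightarrow> norm (v s - l) < e"
        using tendstoD[OF l \<open>e > 0\<close>] unfolding eventually_at dist_norm by blast
      have "norm ((u s - u t) /\<^sub>R (s - t) - l) \<le> e" if s: "s \<in> T" "s \<noteq> t" "dist s t < d" for s
      proof -
        have st: "s < t" using le_Sup[OF s(1)] s(2) 2 by auto
        have "norm ((u t - t *\<^sub>R l) - (u s - s *\<^sub>R l)) \<le> e * (t - s)"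
        proof (rule delta_mean_value[OF s(1) t])
          show "continuous_on T (\<lambda>t. u t - t *\<^sub>R l)" by (intro continuous_intros contu)
          fix r assume r: "r \<in> T" "s \<le> r" "r < t"
          have "has_delta_deriv T (\<lambda>t. t *\<^sub>R l) (1 *\<^sub>R l) r"
            using r by (intro has_delta_deriv_bounded_linear[OF bounded_linear_scaleR_left] has_delta_deriv_ident)
          then have "has_delta_deriv T (\<lambda>t. u t - t *\<^sub>R l) (v r - l) r"
            using has_delta_deriv_diff[OF r(1) deriv[of r]] r K by simp
          moreover have "norm (v r - l) \<le> e"
            using r s st by (intro less_imp_le[OF d(2)]) (auto simp: dist_real_def)
          ultimately show "\<exists>D. has_delta_deriv T (\<lambda>t. u t - t *\<^sub>R l) D r \<and> norm D \<le> e" by blast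
        qed (use st in simp)
        moreover have "(u s - u t) /\<^sub>R (s - t) - l = ((u t - t *\<^sub>R l) - (u s - s *\<^sub>R l)) /\<^sub>R (t - s)"
        proof -
          have 1: "(u t - t *\<^sub>R l) - (u s - s *\<^sub>R l) = (u t - u s) - (t - s) *\<^sub>R l"
            by (simp add: algebra_simps)
          have 2: "(u s - u t) /\<^sub>R (s - t) = (u t - u s) /\<^sub>R (t - s)"
            by (metis inverse_minus_eq minus_diff_eq scaleR_minus_left scaleR_minus_right)
          show ?thesis unfolding 1 2 using st by (simp add: scaleR_diff_right)
        qed
        ultimately show ?thesis using st by (simp add: divide_simps mult.commute)
      qed
      then have "eventually (\<lambda>s. norm ((u s - u t) /\<^sub>R (s - t) - l) \<le> e) (at t within T)"
        using d(1) unfolding eventually_at by blast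
      moreover have "((\<lambda>s. norm ((u s - u t) /\<^sub>R (s - t) - l)) \<longlongrightarrow> norm (v t - l)) (at t within T)"
        using deriv[OF tK] sigma_eq_if_left_dense[OF t K(2,3)] t
        by (intro tendsto_intros) (simp add: has_delta_deriv_iff flip: has_vector_derivative_iff_quotient)
      moreover have "at t within T \<noteq> bot"
        using islimpt_of_left_dense[OF t K(2,3)] by (simp add: trivial_limit_within)
      ultimately show ?thesis using tendsto_upperbound by blast
    qed
    then have "norm (v t - l) \<le> 0" by (rule field_le_epsilon[of _ 0, simplified])
    then show ?thesis using l K by (simp add: continuous_within)
  qed
  then show "continuous (at t within K) (delta_deriv T u)" by (simp add: v_def)
qed

lemma C1rdD:
  assumes "u \<in> C1rd T"
  shows "t \<in> K \<Longrightarrow> has_delta_deriv T u (delta_deriv T u t) t"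
    and "continuous_on T u"
    and "continuous_on K (delta_deriv T u)"
proof -
  have ex: "\<And>t. t \<in> K \<Longrightarrow> \<exists>D. has_delta_deriv T u D t" using assms by (auto simp: C1rd_def)
  then show "t \<in> K \<Longrightarrow> has_delta_deriv T u (delta_deriv T u t) t"
    using delta_deriv_eq[of t u] by metis
  show "continuous_on T u" by (rule delta_differentiable_continuous_on[OF ex])
qed (rule C1rd_continuous[OF assms])

lemma C1rdI:
  assumes "\<And>t. t \<in> K \<Longrightarrow> has_delta_deriv T u (v t) t" "continuous_on K v"
  shows "u \<in> C1rd T"
proof -
  have "delta_deriv T u t = v t" if "t \<in> K" for t     using that assms(1)[OF that] by (rule delta_deriv_eq)
  then have cont: "continuous_on K (delta_deriv T u)"
    using assms(2) by (simp cong: continuous_on_cong)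
  have "\<exists>l. (delta_deriv T u \<longlongrightarrow> l) (at t within K \<inter> {..<t})" if "t \<in> K" for t
    using cont that by (intro exI[of _ "delta_deriv T u t"])
      (auto simp: continuous_on_def intro: tendsto_within_subset)
  then show ?thesis
    using cont assms(1) by (auto simp: C1rd_def rd_continuous_on_def continuous_on_eq_continuous_within)
qed

end

section \<open>Nabla derivatives and the lemma of du Bois-Reymond\<close>

context compact_time_scale
begin

lemma has_delta_deriv_cong:
  assumes "t \<in> T" "\<And>s. s \<in> T \<Longrightarrow> f s = g s"
  shows "has_delta_deriv T f D t \<longleftrightarrow> has_delta_deriv T g D t"
  unfolding has_delta_deriv_def using assms
  by (intro filterlim_cong refl) (auto simp: eventually_inf_principal)

lemma has_nabla_deriv_diff:
  fixes f g :: "real \<Rightarrow> 'a::real_normed_vector"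
  assumes "has_nabla_deriv T S f D t" "has_nabla_deriv T S g E t"
  shows "has_nabla_deriv T S (\<lambda>s. f s - g s) (D - E) t"
proof -
  have "(f s - g s - (f r - g r)) /\<^sub>R c = (f s - f r) /\<^sub>R c - (g s - g r) /\<^sub>R c" for s r c
    by (simp add: algebra_simps)
  then show ?thesis
    using assms unfolding has_nabla_deriv_def by (auto intro: tendsto_diff)
qed

lemma has_nabla_deriv_add:
  fixes f g :: "real \<Rightarrow> 'a::real_normed_vector"
  assumes "has_nabla_deriv T S f D t" "has_nabla_deriv T S g E t"
  shows "has_nabla_deriv T S (\<lambda>s. f s + g s) (D + E) t"
proof -
  have "(f s + g s - (f r + g r)) /\<^sub>R c = (f s - f r) /\<^sub>R c + (g s - g r) /\<^sub>R c" for s r c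
    by (simp add: algebra_simps)
  then show ?thesis
    using assms unfolding has_nabla_deriv_def by (auto intro: tendsto_add)
qed

lemma nabla_deriv_eq:
  fixes f :: "real \<Rightarrow> 'a::real_normed_vector"
  assumes "t \<in> lower_kappa T" "has_nabla_deriv T T f D t"
  shows "nabla_deriv T T f t = D"
  unfolding nabla_deriv_def
proof (rule the_equality[of "\<lambda>D. has_nabla_deriv T T f D t", OF assms(2)])
  fix D' assume D': "has_nabla_deriv T T f D' t"
  have t: "t \<in> T" using assms(1) by (simp add: mem_lower_kappa_iff)
  show "D' = D"
  proof (cases "\<rho> t = t")
    case True
    have "t islimpt T"
      using assms(1) True Inf_le[OF t] Inf_less_Sup islimpt_of_left_dense[OF t]
        islimpt_of_right_dense[OF t]
      by (cases "t = Inf T") (auto simp: mem_lower_kappa_iff)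
    then have "\<not> trivial_limit (at t within T)" by (simp add: trivial_limit_within)
    then show ?thesis
      using assms(2) D' True t vector_derivative_unique_within[of t T f D' D]
      by (simp add: has_nabla_deriv_iff)
  next
    case False
    then have "(t - \<rho> t) *\<^sub>R D' = (t - \<rho> t) *\<^sub>R D"
      using assms(2) D' t by (simp add: has_nabla_deriv_iff)
    then show ?thesis using False by simp
  qed
qed

text \<open>
  The nabla derivative controls steps backward, so the mean value inequality with \<open>M = 0\<close> is applied
  to the reflection of \<open>f\<close> at the origin.
\<close>

lemma nabla_zero_imp_constant:
  fixes f :: "real \<Rightarrow> 'a::real_normed_vector"
  assumes nabla: "\<And>t. t \<in> K \<inter> lower_kappa T \<Longrightarrow> has_nabla_deriv T K f 0 t" and t: "t \<in> K"
  shows "f t = f (Inf T)"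
proof -
  have "continuous (at s within K) f" if s: "s \<in> K" for s
  proof (cases "s \<in> lower_kappa T")
    case True
    then show ?thesis
      using nabla[of s] s has_vector_derivative_continuous
      by (auto simp: has_nabla_deriv_iff split: if_splits)
  next
    case False
    have sT: "s \<in> T" using s K_subset by auto
    then have "s = Inf T" "Inf T < \<sigma> (Inf T)"
      using False Inf_le[of s] sigma_ge[OF Inf_in] by (auto simp: mem_lower_kappa_iff)
    then have "at s within T = bot" using at_within_eq_bot[OF sT] by simp
    then have "at s within K = bot" using at_le[OF K_subset, of s] by (simp add: bot.extremum_unique)
    then show ?thesis by simp
  qed
  then have cont: "continuous_on K f" by (simp add: continuous_on_eq_continuous_within)
  have "norm (f (- (- Inf T)) - f (- (- t))) \<le> 0 * ((- Inf T) - (- t))"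
  proof (rule norm_diff_le_of_forward_steps[of "uminus ` K" "- t" "- Inf T" "\<lambda>s. f (- s)"])
    show "compact (uminus ` K)" by (intro compact_continuous_image compact_K continuous_intros)
    show "continuous_on (uminus ` K) (\<lambda>s. f (- s))"
      by (rule continuous_on_compose2[OF cont]) (auto intro!: continuous_intros)
    show "- t \<le> - Inf T" using t K_subset Inf_le by auto
    fix m e :: real assume "m \<in> uminus ` K" and m: "- t \<le> m" "m < - Inf T" and e: "0 < e"
    then obtain r where r: "m = - r" "r \<in> K" by blast
    then have rT: "r \<in> T" "Inf T < r" using K_subset m by auto
    then have rn: "has_nabla_deriv T K f 0 r" using nabla[of r] r by (simp add: mem_lower_kappa_iff)
    have "\<exists>s\<in>K. s < r \<and> norm (f s - f r) \<le> e * (r - s)"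
    proof (cases "\<rho> r = r")
      case True
      then obtain d where d: "d > 0"
          "\<And>s. s \<in> K \<Longrightarrow> \<bar>s - r\<bar> < d \<Longrightarrow> norm (f s - f r) \<le> e * \<bar>s - r\<bar>"
        using has_vector_derivative_step[of f 0 r K e] rn e r(2) by (auto simp: has_nabla_deriv_iff)
      obtain s where s: "s \<in> T" "r - d < s" "s < r"
        using rho_approx[OF rT True, of "r - d"] d(1) by auto
      then have "s \<in> K" using mem_K_if_less rT by blast
      then show ?thesis using d(2)[of s] s by (intro bexI[of _ s]) auto
    next
      case False
      then have "\<rho> r < r" using rT rho_lt_iff by blast
      then have "\<rho> r \<in> K" using mem_K_if_less rT by auto
      then show ?thesis
        using False rn r(2) \<open>\<rho> r < r\<close> e by (intro bexI[of _ "\<rho> r"]) (auto simp: has_nabla_deriv_iff)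
    qed
    then obtain s where "s \<in> K" "s < r" "norm (f s - f r) \<le> e * (r - s)" by blast
    then show "\<exists>s\<in>uminus ` K. m < s \<and> s \<le> - Inf T \<and> norm (f (- s) - f (- m)) \<le> (0 + e) * (s - m)"
      using K_subset Inf_le r(1) by (intro bexI[of _ "- s"]) (auto simp: algebra_simps)
  qed (use t Inf_in_K in auto)
  then show ?thesis by simp
qed

text \<open>
  Subtracting \<open>M / 2\<close> from a derivative with values between \<open>0\<close> and \<open>M\<close> leaves one bounded by
  \<open>M / 2\<close> in absolute value, so monotonicity follows from the mean value inequality.
\<close>

lemma delta_nondecreasing:
  fixes f :: "real \<Rightarrow> real"
  assumes deriv: "\<And>t. t \<in> K \<Longrightarrow> has_delta_deriv T f (D t) t"
    and bounds: "\<And>t. t \<in> K \<Longrightarrow> 0 \<le> D t \<and> D t \<le> M"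
    and "x \<in> T" "y \<in> T" "x \<le> y"
  shows "f x \<le> f y"
proof -
  define g where "g t = f t - M / 2 * t" for t
  have g: "has_delta_deriv T g (D t - M / 2) t" if "t \<in> K" for t
    using has_delta_deriv_diff[OF _ deriv[OF that] has_delta_deriv_scaleR[OF _ has_delta_deriv_ident],
        of "M / 2"] that K_subset by (auto simp: g_def[abs_def])
  have "norm (g y - g x) \<le> M / 2 * (y - x)"
  proof (rule delta_mean_value[OF assms(3-5)])
    show "continuous_on T g" by (rule delta_differentiable_continuous_on) (use g in blast)
    fix t assume "t \<in> T" "x \<le> t" "t < y"
    then have "t \<in> K" using mem_K_if_less assms(4) by blast
    then show "\<exists>D. has_delta_deriv T g D t \<and> norm D \<le> M / 2"
      using g[of t] bounds[of t] by (intro exI[of _ "D t - M / 2"]) (auto simp: abs_if)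
  qed
  then have "- (M / 2 * (y - x)) \<le> g y - g x" unfolding real_norm_def by linarith
  moreover have "g y - g x = (f y - f x) - M / 2 * (y - x)" by (simp add: g_def right_diff_distrib)
  ultimately show ?thesis by linarith
qed

text \<open>
  The antiderivative is nondecreasing with equal values at both ends, hence constant, and \<open>h\<close> is
  its derivative.
\<close>

lemma delta_integral_nonneg_eq_0:
  fixes h :: "real \<Rightarrow> real"
  assumes cont: "continuous_on K h" and nonneg: "\<And>t. t \<in> K \<Longrightarrow> 0 \<le> h t"
    and zero: "delta_integral T h (Sup T) = 0" and t: "t \<in> K"
  shows "h t = 0"
proof -
  obtain H where H: "\<And>t. t \<in> K \<Longrightarrow> has_delta_deriv T H (h t) t" "H (Inf T) = 0"
    using antiderivative_exists[OF cont] by metis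
  have "H (Sup T) = 0" using delta_integral_eq[OF H(1) Sup_in] zero H(2) by simp
  moreover obtain M where "\<And>t. t \<in> K \<Longrightarrow> h t \<le> M"
    using compact_attains_sup[OF compact_continuous_image[OF cont compact_K]] Inf_in_K by auto
  ultimately have "H s = 0" if "s \<in> T" for s
    using delta_nondecreasing[of H h M "Inf T" s] delta_nondecreasing[of H h M s "Sup T"]
      that H nonneg Inf_in Sup_in Inf_le le_Sup by force
  then have "has_delta_deriv T (\<lambda>s. 0) (h t) t"
    using has_delta_deriv_cong[of t H "\<lambda>s. 0" "h t"] H(1)[OF t] K_subset t by auto
  then show ?thesis
    using has_delta_deriv_unique[OF t _ has_delta_deriv_const] K_subset t by blast
qed

end

context sigma_nabla_time_scale
begin

text \<open>
  If \<open>\<rho> t = t\<close>, then also \<open>\<sigma> t = t\<close>, both derivatives are ordinary derivatives within \<open>T\<close>, and the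
  formula is the chain rule. If \<open>\<rho> t < t\<close>, then \<open>\<sigma> (\<rho> t) = t\<close>, so both sides multiplied by
  \<open>t - \<rho> t\<close> are the jump \<open>P (\<sigma> t) - P t\<close>.
\<close>

lemma has_nabla_deriv_comp_sigma:
  fixes P :: "real \<Rightarrow> 'a::real_normed_vector"
  assumes P: "\<And>s. s \<in> K \<Longrightarrow> has_delta_deriv T P (p s) s" and t: "t \<in> K \<inter> lower_kappa T"
  shows "has_nabla_deriv T K (\<lambda>s. P (\<sigma> s)) (nabla_deriv T T \<sigma> t *\<^sub>R p t) t"
proof -
  have tK: "t \<in> K" and tT: "t \<in> T" using t K_subset by auto
  define D where "D = nabla_deriv T T \<sigma> t"
  have D: "has_nabla_deriv T T \<sigma> D t"
    using sigma_nabla[of t] nabla_deriv_eq[of t \<sigma>] t by (auto simp: D_def)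
  show ?thesis
  proof (cases "\<rho> t = t")
    case True
    then have st: "\<sigma> t = t" using t sigma_eq_if_rho_eq by blast
    have "(\<sigma> has_vector_derivative D) (at t within K)"
      using D True tT K_subset
      by (auto simp: has_nabla_deriv_iff intro: has_vector_derivative_within_subset)
    moreover have "(P has_vector_derivative p t) (at (\<sigma> t) within \<sigma> ` K)"
      using P[OF tK] tT st has_vector_derivative_within_subset[of P "p t" t T "\<sigma> ` K"]
        image_subset_iff[of \<sigma> K T] sigma_in subsetD[OF K_subset]
      by (simp add: has_delta_deriv_iff)
    ultimately have "((\<lambda>s. P (\<sigma> s)) has_vector_derivative D *\<^sub>R p t) (at t within K)"
      using vector_diff_chain_within[of \<sigma> D t K P "p t"] by (simp add: o_def)
    then show ?thesis using True tK by (simp add: has_nabla_deriv_iff D_def)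
  next
    case False
    then have rt: "\<sigma> (\<rho> t) = t" using sigma_rho tT rho_lt_iff by blast
    have "continuous_on T P" by (rule delta_differentiable_continuous_on) (use P in blast)
    then have "continuous_on T (\<lambda>s. P (\<sigma> s))"
      by (rule continuous_on_compose2[OF _ sigma_continuous]) auto
    then have "continuous (at t within K) (\<lambda>s. P (\<sigma> s))"
      using tK continuous_on_subset[OF _ K_subset] unfolding continuous_on_eq_continuous_within by blast
    moreover have "\<sigma> t - t = (t - \<rho> t) * D"
      using D False tT rt by (simp add: has_nabla_deriv_iff)
    then have "P (\<sigma> t) - P t = (t - \<rho> t) *\<^sub>R (D *\<^sub>R p t)"
      using delta_deriv_jump[OF tT P[OF tK]] by simp
    ultimately show ?thesis using False tK rt by (simp add: has_nabla_deriv_iff D_def)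
  qed
qed

text \<open>
  For the nontrivial direction let \<open>c\<close> be the mean value of \<open>g\<close>. The antiderivative \<open>w\<close> of \<open>g - c\<close>
  vanishes at both ends, and testing with it gives \<open>\<integral> (g - c) \<bullet> (g - c) \<Delta>t = 0\<close>.
\<close>

lemma du_Bois_Reymond:
  fixes g :: "real \<Rightarrow> 'a::euclidean_space"
  assumes cont: "continuous_on K g"
  shows "(\<forall>w\<in>C1rd0 T. delta_integral T (\<lambda>t. g t \<bullet> delta_deriv T w t) (Sup T) = 0) \<longleftrightarrow>
    (\<forall>t\<in>K. g t = g (Inf T))"
proof
  assume const: "\<forall>t\<in>K. g t = g (Inf T)"
  show "\<forall>w\<in>C1rd0 T. delta_integral T (\<lambda>t. g t \<bullet> delta_deriv T w t) (Sup T) = 0"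
  proof
    fix w :: "real \<Rightarrow> 'a" assume "w \<in> C1rd0 T"
    then have w: "w \<in> C1rd T" "w (Inf T) = 0" "w (Sup T) = 0" by (auto simp: C1rd0_def)
    have "has_delta_deriv T (\<lambda>s. g (Inf T) \<bullet> w s) (g t \<bullet> delta_deriv T w t) t" if "t \<in> K" for t
      using has_delta_deriv_bounded_linear[OF bounded_linear_inner_right _ C1rdD(1)[OF w(1) that]]
        that K_subset const by auto
    then show "delta_integral T (\<lambda>t. g t \<bullet> delta_deriv T w t) (Sup T) = 0"
      using delta_integral_eq[of "\<lambda>s. g (Inf T) \<bullet> w s" _ "Sup T"] Sup_in w by simp
  qed
next
  assume *: "\<forall>w\<in>C1rd0 T. delta_integral T (\<lambda>t. g t \<bullet> delta_deriv T w t) (Sup T) = 0"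
  obtain G where G: "\<And>t. t \<in> K \<Longrightarrow> has_delta_deriv T G (g t) t" "G (Inf T) = 0"
    using antiderivative_exists[OF cont] by metis
  define c where "c = G (Sup T) /\<^sub>R (Sup T - Inf T)"
  define w where "w t = G t - (t - Inf T) *\<^sub>R c" for t
  have w: "has_delta_deriv T w (g t - c) t" if "t \<in> K" for t
  proof -
    have t: "t \<in> T" using that K_subset by auto
    have "has_delta_deriv T (\<lambda>t. (t - Inf T) *\<^sub>R c) ((1 - 0) *\<^sub>R c) t"
      by (intro has_delta_deriv_bounded_linear[OF bounded_linear_scaleR_left]
          has_delta_deriv_diff has_delta_deriv_ident has_delta_deriv_const t)
    then show ?thesis unfolding w_def using has_delta_deriv_diff[OF t G(1)[OF that]] by simp
  qed
  have w_ends: "w (Inf T) = 0" "w (Sup T) = 0"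
    using G(2) Inf_less_Sup by (auto simp: w_def c_def)
  have "continuous_on K (\<lambda>t. g t - c)" by (intro continuous_intros cont)
  then have "w \<in> C1rd0 T"
    using C1rdI[OF w] w_ends by (simp add: C1rd0_def)
  define h where "h t = (g t - c) \<bullet> (g t - c)" for t
  have h_cont: "continuous_on K h" unfolding h_def by (intro continuous_intros cont)
  obtain H where H: "\<And>t. t \<in> K \<Longrightarrow> has_delta_deriv T H (h t) t" "H (Inf T) = 0"
    using antiderivative_exists[OF h_cont] by metis
  \<comment> \<open>the constant \<open>c\<close> contributes \<open>c \<bullet> w\<close> to the antiderivative, which vanishes at both ends\<close>
  have "has_delta_deriv T (\<lambda>s. H s + c \<bullet> w s) (g t \<bullet> delta_deriv T w t) t" if "t \<in> K" for t
  proof -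
    have t: "t \<in> T" using that K_subset by auto
    have "has_delta_deriv T (\<lambda>s. H s + c \<bullet> w s) (h t + c \<bullet> (g t - c)) t"
      by (intro has_delta_deriv_add t H that
          has_delta_deriv_bounded_linear[OF bounded_linear_inner_right] w)
    moreover have "h t + c \<bullet> (g t - c) = g t \<bullet> delta_deriv T w t"
      using delta_deriv_eq[OF that w[OF that]] by (simp add: h_def inner_diff_left)
    ultimately show ?thesis by simp
  qed
  from delta_integral_eq[OF this Sup_in] have "H (Sup T) = 0"
    using * \<open>w \<in> C1rd0 T\<close> H(2) w_ends by simp
  then have "delta_integral T h (Sup T) = 0" using delta_integral_eq[OF H(1) Sup_in] H(2) by simp
  then have "h t = 0" if "t \<in> K" for t
    using delta_integral_nonneg_eq_0[OF h_cont] that by (simp add: h_def)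
  then show "\<forall>t\<in>K. g t = g (Inf T)" using Inf_in_K by (simp add: h_def)
qed

end

section \<open>The Gateaux differential of the functional\<close>

lemma gradient_works:
  fixes f :: "'a::euclidean_space \<Rightarrow> real"
  assumes "f differentiable (at x)"
  shows "(f has_derivative (\<lambda>h. h \<bullet> gradient f x)) (at x)"
proof -
  obtain f' where f': "(f has_derivative f') (at x)" using assms by (auto simp: differentiable_def)
  have "linear f'" using f' by (rule has_derivative_linear)
  then have "f' h = h \<bullet> adjoint f' 1" for h using adjoint_works[of f' h 1] by simp
  then have "GDERIV f x :> adjoint f' 1" using f' unfolding gderiv_def by (metis ext)
  moreover have "D = adjoint f' 1" if "GDERIV f x :> D" for D
  proof -
    have "(\<lambda>h. h \<bullet> D) = (\<lambda>h. h \<bullet> adjoint f' 1)"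
      using that \<open>GDERIV f x :> adjoint f' 1\<close> unfolding gderiv_def by (rule has_derivative_unique)
    then show ?thesis by (metis vector_eq_ldot)
  qed
  ultimately have "GDERIV f x :> gradient f x" unfolding gradient_def by (rule theI)
  then show ?thesis by (simp add: gderiv_def)
qed

text \<open>
  The total derivative at \<open>(X, V)\<close> restricted to the two coordinate subspaces is given by the partial
  gradients, and by linearity it is determined by these restrictions.
\<close>

lemma DERIV_along_line:
  fixes L :: "'a::euclidean_space \<Rightarrow> 'a \<Rightarrow> real \<Rightarrow> real"
  assumes "\<And>x v. (\<lambda>(y, z). L y z t) differentiable at (x, v)"
  shows "((\<lambda>\<epsilon>. L (x + \<epsilon> *\<^sub>R h) (v + \<epsilon> *\<^sub>R k) t) has_real_derivative
    dL_dx L (x + \<epsilon> *\<^sub>R h) (v + \<epsilon> *\<^sub>R k) t \<bullet> h + dL_dv L (x + \<epsilon> *\<^sub>R h) (v + \<epsilon> *\<^sub>R k) t \<bullet> k) (at \<epsilon>)"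
proof -
  define X where "X = x + \<epsilon> *\<^sub>R h"
  define V where "V = v + \<epsilon> *\<^sub>R k"
  define \<Phi> where "\<Phi> = (\<lambda>p. L (fst p) (snd p) t)"
  have "\<Phi> differentiable at (X, V)" using assms[of X V] by (simp add: \<Phi>_def case_prod_beta')
  then obtain F where F: "(\<Phi> has_derivative F) (at (X, V))" by (auto simp: differentiable_def)
  have "((\<lambda>y. \<Phi> (y, V)) has_derivative (\<lambda>d. F (d, 0))) (at X)"
    by (rule has_derivative_compose[of "\<lambda>y. (y, V)", OF _ F]) (auto intro!: derivative_eq_intros)
  moreover from this have "((\<lambda>y. \<Phi> (y, V)) has_derivative (\<lambda>d. d \<bullet> dL_dx L X V t)) (at X)"
    unfolding dL_dx_def \<Phi>_def using gradient_works[of "\<lambda>y. L y V t" X] by (auto simp: differentiable_def)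
  ultimately have x: "F (d, 0) = d \<bullet> dL_dx L X V t" for d by (metis has_derivative_unique)
  have "((\<lambda>z. \<Phi> (X, z)) has_derivative (\<lambda>d. F (0, d))) (at V)"
    by (rule has_derivative_compose[of "\<lambda>z. (X, z)", OF _ F]) (auto intro!: derivative_eq_intros)
  moreover from this have "((\<lambda>z. \<Phi> (X, z)) has_derivative (\<lambda>d. d \<bullet> dL_dv L X V t)) (at V)"
    unfolding dL_dv_def \<Phi>_def using gradient_works[of "\<lambda>z. L X z t" V] by (auto simp: differentiable_def)
  ultimately have v: "F (0, d) = d \<bullet> dL_dv L X V t" for d by (metis has_derivative_unique)
  have lin: "linear F" using F by (rule has_derivative_linear)
  have F_eq: "F (e *\<^sub>R h, e *\<^sub>R k) = e * (dL_dx L X V t \<bullet> h + dL_dv L X V t \<bullet> k)" for e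
  proof -
    have "F (e *\<^sub>R h, e *\<^sub>R k) = F (e *\<^sub>R h, 0) + F (0, e *\<^sub>R k)"
      using linear_add[OF lin, of "(e *\<^sub>R h, 0)" "(0, e *\<^sub>R k)"] by simp
    then show ?thesis by (simp add: x v inner_commute distrib_left)
  qed
  have "((\<lambda>\<epsilon>. (x + \<epsilon> *\<^sub>R h, v + \<epsilon> *\<^sub>R k)) has_derivative (\<lambda>e. (e *\<^sub>R h, e *\<^sub>R k))) (at \<epsilon>)"
    by (auto intro!: derivative_eq_intros)
  from has_derivative_compose[OF this, of \<Phi> F] F
  have "((\<lambda>\<epsilon>. \<Phi> (x + \<epsilon> *\<^sub>R h, v + \<epsilon> *\<^sub>R k)) has_derivative (\<lambda>e. F (e *\<^sub>R h, e *\<^sub>R k))) (at \<epsilon>)"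
    by (simp add: X_def V_def)
  then show ?thesis
    unfolding F_eq has_field_derivative_def X_def[symmetric] V_def[symmetric]
    by (simp add: \<Phi>_def mult.commute[of _ "_ + _"] mult_commute_abs)
qed

context sigma_nabla_time_scale
begin

text \<open>
  By the mean value theorem the difference quotient of the integrand at \<open>t\<close> equals \<open>\<phi> \<theta> t\<close> for some
  \<open>\<theta>\<close> between \<open>0\<close> and \<open>\<epsilon>\<close>, where \<open>\<phi> \<theta>\<close> is the derivative of the integrand in \<open>\<theta>\<close>. Uniform
  continuity of \<open>\<phi>\<close> on a compact set makes the convergence to \<open>\<phi> 0 t\<close> uniform in \<open>t\<close>, and the mean
  value inequality carries this over to the integrals.
\<close>

lemma gateaux_differential:
  fixes L :: "'a::euclidean_space \<Rightarrow> 'a \<Rightarrow> real \<Rightarrow> real"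
  assumes L: "lagrangian T L" and u: "u \<in> C1rd T" and w: "w \<in> C1rd T"
  shows "has_gateaux_differential (lagrangian_functional T L) u w
    (delta_integral T (\<lambda>t. dL_dx L (u t) (delta_deriv T u t) t \<bullet> w t +
        dL_dv L (u t) (delta_deriv T u t) t \<bullet> delta_deriv T w t) (Sup T))"
proof -
  define u' where "u' = delta_deriv T u"
  define w' where "w' = delta_deriv T w"
  have contL: "continuous_on (UNIV \<times> UNIV \<times> K) (\<lambda>(x, v, t). L x v t)"
    and contx: "continuous_on (UNIV \<times> UNIV \<times> K) (\<lambda>(x, v, t). dL_dx L x v t)"
    and contv: "continuous_on (UNIV \<times> UNIV \<times> K) (\<lambda>(x, v, t). dL_dv L x v t)"
    and diffL: "\<And>t x v. t \<in> K \<Longrightarrow> (\<lambda>(y, z). L y z t) differentiable at (x, v)"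
    using L unfolding lagrangian_def by auto
  note cu = continuous_on_subset[OF C1rdD(2)[OF u] K_subset] C1rdD(3)[OF u, folded u'_def]
  note cw = continuous_on_subset[OF C1rdD(2)[OF w] K_subset] C1rdD(3)[OF w, folded w'_def]
  have snd_comp: "continuous_on (A \<times> K) (\<lambda>z. f (snd z))" if "continuous_on K f"
    for f :: "real \<Rightarrow> 'a" and A :: "real set"
    by (rule continuous_on_compose2[OF that]) (auto intro!: continuous_intros)
  define pt where "pt z = (u (snd z) + fst z *\<^sub>R w (snd z), u' (snd z) + fst z *\<^sub>R w' (snd z), snd z)"
    for z :: "real \<times> real"
  have pt: "continuous_on (A \<times> K) pt" for A
    unfolding pt_def by (intro continuous_intros snd_comp cu cw)
  define Lw where "Lw \<epsilon> t = L (u t + \<epsilon> *\<^sub>R w t) (u' t + \<epsilon> *\<^sub>R w' t) t" for \<epsilon> t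
  define \<phi> where "\<phi> \<epsilon> t = dL_dx L (u t + \<epsilon> *\<^sub>R w t) (u' t + \<epsilon> *\<^sub>R w' t) t \<bullet> w t +
    dL_dv L (u t + \<epsilon> *\<^sub>R w t) (u' t + \<epsilon> *\<^sub>R w' t) t \<bullet> w' t" for \<epsilon> t
  have deriv: "((\<lambda>\<epsilon>. Lw \<epsilon> t) has_real_derivative \<phi> \<epsilon> t) (at \<epsilon>)" if "t \<in> K" for \<epsilon> t
    unfolding Lw_def \<phi>_def by (rule DERIV_along_line) (rule diffL[OF that])
  have comp: "continuous_on (A \<times> K) (\<lambda>z. f (u (snd z) + fst z *\<^sub>R w (snd z)) (u' (snd z) + fst z *\<^sub>R w' (snd z)) (snd z))"
    if "continuous_on (UNIV \<times> UNIV \<times> K) (\<lambda>(x, v, t). f x v t)"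
    for f :: "'a \<Rightarrow> 'a \<Rightarrow> real \<Rightarrow> 'b::topological_space" and A
  proof -
    have "pt ` (A \<times> K) \<subseteq> UNIV \<times> UNIV \<times> K" by (auto simp: pt_def)
    from continuous_on_compose2[OF that pt this] show ?thesis by (simp add: pt_def)
  qed
  have \<phi>_cont: "continuous_on (A \<times> K) (\<lambda>z. \<phi> (fst z) (snd z))" for A
    unfolding \<phi>_def by (intro continuous_intros comp contx contv snd_comp cw)
  have Lw_cont: "continuous_on (A \<times> K) (\<lambda>z. Lw (fst z) (snd z))" for A
    unfolding Lw_def by (intro comp contL)
  have slice: "continuous_on K (f \<epsilon>)" if "continuous_on (UNIV \<times> K) (\<lambda>z. f (fst z) (snd z))"
    for f :: "real \<Rightarrow> real \<Rightarrow> real" and \<epsilon>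
  proof -
    have 1: "continuous_on K (\<lambda>t. (\<epsilon>, t))" by (intro continuous_intros)
    have 2: "(\<lambda>t. (\<epsilon>, t)) ` K \<subseteq> UNIV \<times> K" by auto
    from continuous_on_compose2[OF that 1 2] show ?thesis by simp
  qed
  define J where "J = lagrangian_functional T L"
  have J: "J (\<lambda>t. u t + \<epsilon> *\<^sub>R w t) = delta_integral T (Lw \<epsilon>) (Sup T)" for \<epsilon>
    unfolding J_def lagrangian_functional_def
  proof (rule delta_integral_cong)
    fix t assume t: "t \<in> K"
    have "has_delta_deriv T (\<lambda>t. u t + \<epsilon> *\<^sub>R w t) (u' t + \<epsilon> *\<^sub>R w' t) t"
      using t K_subset C1rdD(1)[OF u t] C1rdD(1)[OF w t] unfolding u'_def w'_def
      by (intro has_delta_deriv_add has_delta_deriv_scaleR) auto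
    then have "delta_deriv T (\<lambda>t. u t + \<epsilon> *\<^sub>R w t) t = u' t + \<epsilon> *\<^sub>R w' t"
      by (rule delta_deriv_eq[OF t])
    then show "L (u t + \<epsilon> *\<^sub>R w t) (delta_deriv T (\<lambda>t. u t + \<epsilon> *\<^sub>R w t) t) t = Lw \<epsilon> t"
      by (simp add: Lw_def)
  qed
  have J0: "J u = delta_integral T (Lw 0) (Sup T)" using J[of 0] by simp
  obtain \<Phi> where \<Phi>: "\<And>t. t \<in> K \<Longrightarrow> has_delta_deriv T \<Phi> (\<phi> 0 t) t" "\<Phi> (Inf T) = 0"
    using slice[of \<phi> 0, OF \<phi>_cont] by (rule antiderivative_exists) (rule that)
  have "((\<lambda>\<epsilon>. (J (\<lambda>t. u t + \<epsilon> *\<^sub>R w t) - J u) / \<epsilon>) \<longlongrightarrow> \<Phi> (Sup T)) (at 0)"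
  proof (rule tendstoI)
    fix e :: real assume "0 < e"
    define \<eta> where "\<eta> = e / 2 / (Sup T - Inf T)"
    have half: "\<eta> * (Sup T - Inf T) = e / 2"
      using Inf_less_Sup unfolding \<eta>_def by (intro nonzero_eq_divide_eq[THEN iffD1] refl) simp
    have \<eta>: "0 < \<eta>" "\<eta> * (Sup T - Inf T) < e"
      unfolding half using \<open>0 < e\<close> Inf_less_Sup by (simp_all add: \<eta>_def)
    have "uniformly_continuous_on ({-1..1} \<times> K) (\<lambda>z. \<phi> (fst z) (snd z))"
      by (intro compact_uniformly_continuous \<phi>_cont compact_Times compact_K compact_Icc)
    then obtain d where d: "0 < d" "\<And>z z'. \<lbrakk>z \<in> {-1..1} \<times> K; z' \<in> {-1..1} \<times> K; dist z' z < d\<rbrakk> \<Longrightarrow>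
        dist (\<phi> (fst z') (snd z')) (\<phi> (fst z) (snd z)) < \<eta>"
      using \<eta>(1) unfolding uniformly_continuous_on_def by meson
    have "dist ((J (\<lambda>t. u t + \<epsilon> *\<^sub>R w t) - J u) / \<epsilon>) (\<Phi> (Sup T)) < e"
      if \<epsilon>: "\<epsilon> \<noteq> 0" "\<bar>\<epsilon>\<bar> < min d 1" for \<epsilon>
    proof -
      define q where "q t = (Lw \<epsilon> t - Lw 0 t) / \<epsilon>" for t
      have q_close: "\<bar>q t - \<phi> 0 t\<bar> \<le> \<eta>" if t: "t \<in> K" for t
      proof -
        obtain \<theta> where \<theta>: "\<bar>\<theta>\<bar> \<le> \<bar>\<epsilon>\<bar>" "Lw \<epsilon> t - Lw 0 t = \<epsilon> * \<phi> \<theta> t"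
        proof (cases "0 < \<epsilon>")
          case True
          then obtain z where "0 < z" "z < \<epsilon>" "Lw \<epsilon> t - Lw 0 t = (\<epsilon> - 0) * \<phi> z t"
            using MVT2[of 0 \<epsilon> "\<lambda>\<epsilon>. Lw \<epsilon> t" "\<lambda>\<epsilon>. \<phi> \<epsilon> t"] deriv[OF t] by blast
          then show thesis using that[of z] by simp
        next
          case False
          then obtain z where "\<epsilon> < z" "z < 0" "Lw 0 t - Lw \<epsilon> t = (0 - \<epsilon>) * \<phi> z t"
            using MVT2[of \<epsilon> 0 "\<lambda>\<epsilon>. Lw \<epsilon> t" "\<lambda>\<epsilon>. \<phi> \<epsilon> t"] deriv[OF t] \<epsilon>(1) by force
          then show thesis using that[of z] by simp
        qed
        then have "q t = \<phi> \<theta> t" using \<epsilon>(1) by (simp add: q_def)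
        moreover have "dist (\<phi> \<theta> t) (\<phi> 0 t) < \<eta>"
          using d(2)[of "(0, t)" "(\<theta>, t)"] t \<theta>(1) \<epsilon>(2)
          by (auto simp: dist_Pair_Pair abs_le_iff)
        ultimately show ?thesis by (simp add: dist_real_def)
      qed
      obtain \<Lambda> where \<Lambda>: "\<And>t. t \<in> K \<Longrightarrow> has_delta_deriv T \<Lambda> (Lw \<epsilon> t) t" "\<Lambda> (Inf T) = 0"
        using slice[of Lw \<epsilon>, OF Lw_cont] by (rule antiderivative_exists) (rule that)
      obtain \<Lambda>0 where \<Lambda>0: "\<And>t. t \<in> K \<Longrightarrow> has_delta_deriv T \<Lambda>0 (Lw 0 t) t" "\<Lambda>0 (Inf T) = 0"
        using slice[of Lw 0, OF Lw_cont] by (rule antiderivative_exists) (rule that)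
      \<comment> \<open>the antiderivative of the error of the difference quotient\<close>
      define R where "R t = (1 / \<epsilon>) *\<^sub>R (\<Lambda> t - \<Lambda>0 t) - \<Phi> t" for t
      have R: "has_delta_deriv T R (q t - \<phi> 0 t) t" if "t \<in> K" for t
      proof -
        have "has_delta_deriv T R ((1 / \<epsilon>) *\<^sub>R (Lw \<epsilon> t - Lw 0 t) - \<phi> 0 t) t"
          unfolding R_def using that K_subset
          by (intro has_delta_deriv_diff has_delta_deriv_scaleR \<Lambda> \<Lambda>0 \<Phi>) auto
        then show ?thesis by (simp add: q_def)
      qed
      have "norm (R (Sup T) - R (Inf T)) \<le> \<eta> * (Sup T - Inf T)"
      proof (rule delta_mean_value[OF Inf_in Sup_in])
        show "continuous_on T R" by (rule delta_differentiable_continuous_on) (use R in blast)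
        fix t assume "t \<in> T" "t < Sup T"
        then have "t \<in> K" using mem_K_if_less Sup_in by blast
        then show "\<exists>D. has_delta_deriv T R D t \<and> norm D \<le> \<eta>"
          using R q_close by (intro exI[of _ "q t - \<phi> 0 t"]) auto
      qed (use Inf_less_Sup in simp)
      moreover have "R (Sup T) = (J (\<lambda>t. u t + \<epsilon> *\<^sub>R w t) - J u) / \<epsilon> - \<Phi> (Sup T)" "R (Inf T) = 0"
        unfolding J J0 R_def
        using delta_integral_eq[OF \<Lambda>(1) Sup_in] delta_integral_eq[OF \<Lambda>0(1) Sup_in] \<Lambda>(2) \<Lambda>0(2) \<Phi>(2)
        by simp_all
      ultimately show ?thesis using \<eta>(2) by (simp add: dist_real_def)
    qed
    then show "\<forall>\<^sub>F \<epsilon> in at 0. dist ((J (\<lambda>t. u t + \<epsilon> *\<^sub>R w t) - J u) / \<epsilon>) (\<Phi> (Sup T)) < e"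
      unfolding eventually_at using d(1) by (intro exI[of _ "min d 1"]) auto
  qed
  moreover have "\<Phi> (Sup T) = delta_integral T (\<phi> 0) (Sup T)"
    using delta_integral_eq[OF \<Phi>(1) Sup_in] \<Phi>(2) by simp
  moreover have "\<phi> 0 = (\<lambda>t. dL_dx L (u t) (delta_deriv T u t) t \<bullet> w t +
        dL_dv L (u t) (delta_deriv T u t) t \<bullet> delta_deriv T w t)"
    by (simp add: \<phi>_def u'_def w'_def fun_eq_iff)
  ultimately show ?thesis by (simp add: has_gateaux_differential_def J_def)
qed

section \<open>The Euler-Lagrange equation\<close>

lemma rho_in_K: "t \<in> K \<Longrightarrow> \<rho> t \<in> K"
  using rho_le[of t] by (auto simp: mem_K_iff)

lemma has_nabla_deriv_cong:
  assumes "t \<in> K" "\<And>s. s \<in> K \<Longrightarrow> f s = g s"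
  shows "has_nabla_deriv T K f D t \<longleftrightarrow> has_nabla_deriv T K g D t"
  unfolding has_nabla_deriv_def using assms rho_in_K
  by (intro filterlim_cong refl) (auto simp: eventually_inf_principal)

theorem critical_point_iff_euler_lagrange:
  fixes L :: "'a::euclidean_space \<Rightarrow> 'a \<Rightarrow> real \<Rightarrow> real"
  assumes L: "lagrangian T L" and u: "u \<in> C1rd T"
  shows "critical_point T L u \<longleftrightarrow>
    (\<forall>t\<in>K \<inter> lower_kappa T.
       has_nabla_deriv T K (\<lambda>s. dL_dv L (u s) (delta_deriv T u s) s)
         (nabla_deriv T T \<sigma> t *\<^sub>R dL_dx L (u t) (delta_deriv T u t) t) t)"
proof -
  define p where "p t = dL_dx L (u t) (delta_deriv T u t) t" for t
  define q where "q t = dL_dv L (u t) (delta_deriv T u t) t" for t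
  have pt: "continuous_on K (\<lambda>t. (u t, delta_deriv T u t, t))"
    by (intro continuous_intros continuous_on_subset[OF C1rdD(2)[OF u] K_subset] C1rdD(3)[OF u])
  have pt_in: "(\<lambda>t. (u t, delta_deriv T u t, t)) ` K \<subseteq> UNIV \<times> UNIV \<times> K" by auto
  have "continuous_on (UNIV \<times> UNIV \<times> K) (\<lambda>(x, v, t). dL_dx L x v t)"
    and "continuous_on (UNIV \<times> UNIV \<times> K) (\<lambda>(x, v, t). dL_dv L x v t)"
    using L by (auto simp: lagrangian_def)
  then have p_cont: "continuous_on K p" and q_cont: "continuous_on K q"
    using continuous_on_compose2[OF _ pt pt_in] by (force simp: p_def q_def)+
  obtain P where P: "\<And>t. t \<in> K \<Longrightarrow> has_delta_deriv T P (p t) t" "P (Inf T) = 0"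
    using antiderivative_exists[OF p_cont] by metis
  define g where "g t = q t - P (\<sigma> t)" for t
  have "continuous_on T P" by (rule delta_differentiable_continuous_on) (use P in blast)
  then have "continuous_on T (\<lambda>s. P (\<sigma> s))"
    by (rule continuous_on_compose2[OF _ sigma_continuous]) auto
  then have g_cont: "continuous_on K g"
    unfolding g_def by (intro continuous_intros q_cont) (rule continuous_on_subset[OF _ K_subset])
  have by_parts: "delta_integral T (\<lambda>t. p t \<bullet> w t + q t \<bullet> delta_deriv T w t) (Sup T) =
      delta_integral T (\<lambda>t. g t \<bullet> delta_deriv T w t) (Sup T)" if "w \<in> C1rd0 T" for w
  proof -
    have w: "w \<in> C1rd T" "w (Inf T) = 0" "w (Sup T) = 0" using that by (auto simp: C1rd0_def)
    have "continuous_on K (\<lambda>t. g t \<bullet> delta_deriv T w t)"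
      by (intro continuous_intros g_cont C1rdD(3)[OF w(1)])
    then obtain G where G: "\<And>t. t \<in> K \<Longrightarrow> has_delta_deriv T G (g t \<bullet> delta_deriv T w t) t"
      and "G (Inf T) = 0"
      by (rule antiderivative_exists) (rule that)
    have "has_delta_deriv T (\<lambda>s. G s + P s \<bullet> w s) (p t \<bullet> w t + q t \<bullet> delta_deriv T w t) t"
      if "t \<in> K" for t
    proof -
      have "has_delta_deriv T (\<lambda>s. G s + P s \<bullet> w s)
          (g t \<bullet> delta_deriv T w t + (p t \<bullet> w t + P (\<sigma> t) \<bullet> delta_deriv T w t)) t"
        using that K_subset
        by (intro has_delta_deriv_add has_delta_deriv_inner G P(1) C1rdD(1)[OF w(1)]) auto
      moreover have "g t \<bullet> delta_deriv T w t + (p t \<bullet> w t + P (\<sigma> t) \<bullet> delta_deriv T w t) =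
          p t \<bullet> w t + q t \<bullet> delta_deriv T w t"
        by (simp add: g_def inner_diff_left)
      ultimately show ?thesis by (simp only:)
    qed
    from delta_integral_eq[OF this Sup_in] delta_integral_eq[OF G Sup_in]
    show ?thesis using w by simp
  qed
  have gateaux_iff: "has_gateaux_differential (lagrangian_functional T L) u w 0 \<longleftrightarrow>
      delta_integral T (\<lambda>t. g t \<bullet> delta_deriv T w t) (Sup T) = 0" if "w \<in> C1rd0 T" for w
  proof -
    have "w \<in> C1rd T" using that by (simp add: C1rd0_def)
    from gateaux_differential[OF L u this]
    have "has_gateaux_differential (lagrangian_functional T L) u w
        (delta_integral T (\<lambda>t. g t \<bullet> delta_deriv T w t) (Sup T))"
      unfolding p_def[symmetric] q_def[symmetric] by_parts[OF that] .
    then show ?thesis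
      unfolding has_gateaux_differential_def using LIM_unique by auto
  qed
  have "critical_point T L u \<longleftrightarrow> (\<forall>t\<in>K. g t = g (Inf T))"
    unfolding critical_point_def using u gateaux_iff du_Bois_Reymond[OF g_cont] by auto
  also have "\<dots> \<longleftrightarrow> (\<forall>t\<in>K \<inter> lower_kappa T. has_nabla_deriv T K q (nabla_deriv T T \<sigma> t *\<^sub>R p t) t)"
  proof
    assume const: "\<forall>t\<in>K. g t = g (Inf T)"
    show "\<forall>t\<in>K \<inter> lower_kappa T. has_nabla_deriv T K q (nabla_deriv T T \<sigma> t *\<^sub>R p t) t"
    proof
      fix t assume t: "t \<in> K \<inter> lower_kappa T"
      have "has_nabla_deriv T K (\<lambda>s. g (Inf T)) 0 t" by (simp add: has_nabla_deriv_def)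
      from has_nabla_deriv_add[OF this has_nabla_deriv_comp_sigma[OF P(1) t]]
      have "has_nabla_deriv T K (\<lambda>s. g (Inf T) + P (\<sigma> s)) (nabla_deriv T T \<sigma> t *\<^sub>R p t) t" by simp
      moreover have "g (Inf T) + P (\<sigma> s) = q s" if "s \<in> K" for s
        using bspec[OF const that] by (simp add: g_def algebra_simps)
      ultimately show "has_nabla_deriv T K q (nabla_deriv T T \<sigma> t *\<^sub>R p t) t"
        using has_nabla_deriv_cong[of t "\<lambda>s. g (Inf T) + P (\<sigma> s)" q] t by blast
    qed
  next
    assume EL: "\<forall>t\<in>K \<inter> lower_kappa T. has_nabla_deriv T K q (nabla_deriv T T \<sigma> t *\<^sub>R p t) t"
    have "has_nabla_deriv T K g 0 t" if "t \<in> K \<inter> lower_kappa T" for t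
      using has_nabla_deriv_diff[OF bspec[OF EL that] has_nabla_deriv_comp_sigma[OF P(1) that]]
      by (simp add: g_def[abs_def])
    then show "\<forall>t\<in>K. g t = g (Inf T)" using nabla_zero_imp_constant by blast
  qed
  finally show ?thesis by (simp add: p_def q_def[abs_def])
qed

end

theorem theorem1:
  fixes T :: "real set"
    and L :: "real ^ 'n \<Rightarrow> real ^ 'n \<Rightarrow> real \<Rightarrow> real"
    and u :: "real \<Rightarrow> real ^ 'n"
  assumes "time_scale T"
    and "bounded T"
    and "infinite T \<or> 3 \<le> card T"
    and "lagrangian T L"
    and "\<forall>t\<in>lower_kappa T. \<exists>D. has_nabla_deriv T T (sigma T) D t"
    and "u \<in> C1rd T"
  shows "critical_point T L u \<longleftrightarrow>
    (\<forall>t\<in>upper_kappa T \<inter> lower_kappa T.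
       has_nabla_deriv T (upper_kappa T)
         (\<lambda>s. dL_dv L (u s) (delta_deriv T u s) s)
         (nabla_deriv T T (sigma T) t *\<^sub>R dL_dx L (u t) (delta_deriv T u t) t) t)"
proof -
  have compact: "compact T"
    using assms(1,2) by (simp add: time_scale_def compact_eq_bounded_closed)
  have "\<not> (\<exists>x. T \<subseteq> {x})"
  proof
    assume "\<exists>x. T \<subseteq> {x}"
    then obtain x where "T \<subseteq> {x}" by blast
    then have "finite T" "card T \<le> 1"
      using finite_subset[of T "{x}"] card_mono[of "{x}" T] by auto
    then show False using assms(3) by linarith
  qed
  then obtain x y where xy: "x \<in> T" "y \<in> T" "x < y" by (metis insertI1 linorder_cases subsetI)
  have "Inf T \<le> x" "y \<le> Sup T"
    using xy compact_imp_bounded[OF compact]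
    by (auto intro: cInf_lower cSup_upper bounded_imp_bdd_above bounded_imp_bdd_below)
  then interpret sigma_nabla_time_scale T
    using compact xy assms(5) by unfold_locales auto
  show ?thesis by (rule critical_point_iff_euler_lagrange[OF assms(4,6)])
qed

end
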